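(* Let $n\ge2$, $k\ge1$. Suppose that $u,w\in\mathcal P_n^k$ and both $\lambda_u$ and $\lambda_w$ are automorphisms of $\mathcal O_n$. If there exists an $i\in\{1,\dots,n\}$ such that the tree corresponding to $f_i^u$ is not isomorphic to the tree corresponding to $f_i^w$ (as directed trees, no labeling involved), then $\lambda_u$ and $\lambda_w$ give rise to distinct elements of $\mathrm{Out}(\mathcal O_n)$.
   Context: For $n\ge2$, $\mathcal O_n$ is the Cuntz algebra, generated by isometries $S_1,\dots,S_n$ with $\sum_i S_iS_i^*=1$. $W_n^k$ is the set of $k$-tuples from $\{1,\dots,n\}$ ($W_n^0$ contains only the empty word), $S_\alpha=S_{\alpha_1}\cdots S_{\alpha_k}$. $P_n^k$ is the group of permutations of $W_n^k$; $w\sim\sigma\in P_n^k$ means $w=\sum_{\alpha\in W_n^k}S_{\sigma(\alpha)}S_\alpha^*$, and $\mathcal P_n^k$ is the set of all such unitaries. For a unitary $u\in\mathcal O_n$, $\lambda_u$ is the unital endomorphism with $\lambda_u(S_i)=u^*S_i$. $\mathrm{Out}(\mathcal O_n)=\mathrm{Aut}(\mathcal O_n)/\mathrm{Inn}(\mathcal O_n)$. For $w\sim\sigma\in P_n^k$ and $i\in\{1,\dots,n\}$, the map $f_i^w:W_n^{k-1}\to W_n^{k-1}$ is defined by: $f_i^w(\alpha)=\beta$ iff there is $m\in\{1,\dots,n\}$ with $(i,\alpha)=\sigma(\beta,m)$. When $\lambda_w$ is an automorphism, each $f_i^w$ has exactly one fixed point and no periodic orbits of length $\ge2$, so its diagram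 (the directed graph with vertex set $W_n^{k-1}$ and an edge from $\alpha$ to $f_i^w(\alpha)$ for each $\alpha$ that is not the fixed point) is a rooted tree, the root being the fixed point; this is the tree corresponding to $f_i^w$. *)

theory Defs
  imports
    Complex_Main
    "HOL-Algebra.Coset"
    "HOL-Combinatorics.Permutations"
    "Graph_Theory.Digraph_Isomorphism"
    "Graph_Theory.Pair_Digraph"
begin

text \<open>
  Complex unital C*-algebras. The superclass \<^class>\<open>real_normed_algebra_1\<close> supplies the ring
  structure, submultiplicativity of the norm and \<open>norm 1 = 1\<close>; in particular the algebra is nonzero.
\<close>

class unital_cstar_algebra = real_normed_algebra_1 + complete_space +
  fixes scaleC :: "complex \<Rightarrow> 'a \<Rightarrow> 'a"
    and adj :: "'a \<Rightarrow> 'a"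
  assumes scaleC_of_real: "scaleC (complex_of_real r) x = scaleR r x"
    and scaleC_add_right: "scaleC c (x + y) = scaleC c x + scaleC c y"
    and scaleC_add_left: "scaleC (c + d) x = scaleC c x + scaleC d x"
    and scaleC_scaleC: "scaleC c (scaleC d x) = scaleC (c * d) x"
    and mult_scaleC_left: "scaleC c x * y = scaleC c (x * y)"
    and mult_scaleC_right: "x * scaleC c y = scaleC c (x * y)"
    and norm_scaleC: "norm (scaleC c x) = cmod c * norm x"
    and adj_adj: "adj (adj x) = x"
    and adj_add: "adj (x + y) = adj x + adj y"
    and adj_mult: "adj (x * y) = adj y * adj x"
    and adj_scaleC: "adj (scaleC c x) = scaleC (cnj c) (adj x)"
    and cstar_identity: "norm (adj x * x) = (norm x)\<^sup>2"

definition unitary :: "'a::unital_cstar_algebra \<Rightarrow> bool" where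
  "unitary z \<longleftrightarrow> adj z * z = 1 \<and> z * adj z = 1"

definition unital_cstar_subalgebra :: "'a::unital_cstar_algebra set \<Rightarrow> bool" where
  "unital_cstar_subalgebra B \<longleftrightarrow> 1 \<in> B \<and> closed B \<and>
     (\<forall>x\<in>B. \<forall>y\<in>B. x + y \<in> B \<and> x * y \<in> B) \<and>
     (\<forall>x\<in>B. adj x \<in> B \<and> (\<forall>c. scaleC c x \<in> B))"

definition unital_star_endomorphism :: "('a::unital_cstar_algebra \<Rightarrow> 'a) \<Rightarrow> bool" where
  "unital_star_endomorphism \<phi> \<longleftrightarrow>
     (\<forall>x y. \<phi> (x + y) = \<phi> x + \<phi> y) \<and>
     (\<forall>x y. \<phi> (x * y) = \<phi> x * \<phi> y) \<and>
     (\<forall>c x. \<phi> (scaleC c x) = scaleC c (\<phi> x)) \<and>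
     (\<forall>x. \<phi> (adj x) = adj (\<phi> x)) \<and>
     \<phi> 1 = 1"

definition Aut :: "('a::unital_cstar_algebra \<Rightarrow> 'a) monoid" where
  "Aut = \<lparr> carrier = {\<phi>. unital_star_endomorphism \<phi> \<and> bij \<phi>}, monoid.mult = (\<circ>), one = id \<rparr>"

definition Inn :: "('a::unital_cstar_algebra \<Rightarrow> 'a) set" where
  "Inn = {\<lambda>x. z * x * adj z | z. unitary z}"

lemma group_Aut: "group (Aut :: ('a::unital_cstar_algebra \<Rightarrow> 'a) monoid)"
proof (rule groupI, goal_cases)
  case (5 x)
  have b: "bij x" using 5 by (simp add: Aut_def)
  have e: "unital_star_endomorphism x" using 5 by (simp add: Aut_def)
  have s: "\<And>y. x (inv_into UNIV x y) = y" "\<And>y. inv_into UNIV x (x y) = y"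
    using b by (auto simp: bij_is_surj surj_f_inv_f bij_is_inj)
  have ii: "\<And>a c. x a = x c \<Longrightarrow> a = c" using b by (metis bij_pointE)
  have "unital_star_endomorphism (inv_into UNIV x)"
    unfolding unital_star_endomorphism_def
  proof (intro conjI allI)
    show "inv_into UNIV x 1 = 1" using e s(2) unfolding unital_star_endomorphism_def by metis
  qed (rule ii, use e in \<open>simp add: s unital_star_endomorphism_def\<close>)+
  then show ?case using b s by (intro bexI[of _ "inv_into UNIV x"]) (auto simp: Aut_def bij_imp_bij_inv)
qed (auto simp: Aut_def unital_star_endomorphism_def bij_comp)

lemma adj_one: "adj (1::'a::unital_cstar_algebra) = 1"
  by (metis adj_adj adj_mult mult_1_right mult_1_left)

lemma Inn_normal: "(Inn :: ('a::unital_cstar_algebra \<Rightarrow> 'a) set) \<lhd> Aut"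
proof -
  have scm: "z * (x * y) * adj z = (z*x*adj z)*(z*y*adj z)" if "unitary z" for x y z :: 'a
    using that unfolding unitary_def by (metis mult.assoc mult_1_right)
  have bj: "bij (\<lambda>x. z * x * adj z)" if "unitary z" for z :: 'a
    by (rule o_bij[of "\<lambda>x. adj z * x * z"])
       (use that in \<open>auto simp: unitary_def fun_eq_iff, (metis mult.assoc mult_1_right mult_1_left)+\<close>)
  have sub: "Inn \<subseteq> carrier (Aut :: ('a \<Rightarrow> 'a) monoid)"
    using scm bj by (auto simp: Inn_def Aut_def unital_star_endomorphism_def
      distrib_left distrib_right mult_scaleC_left mult_scaleC_right adj_mult adj_adj mult.assoc)
      (auto simp: unitary_def)
  show ?thesis
  proof (subst group.normal_inv_iff[OF group_Aut], intro conjI ballI)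
    show "subgroup Inn (Aut :: ('a \<Rightarrow> 'a) monoid)"
    proof (rule group.subgroupI[OF group_Aut sub])
      show "Inn \<noteq> ({} :: ('a \<Rightarrow> 'a) set)" using adj_one by (auto simp: Inn_def unitary_def intro!: exI[of _ 1])
    next
      fix a :: "'a \<Rightarrow> 'a" assume "a \<in> Inn"
      then obtain z where z: "unitary z" "a = (\<lambda>x. z * x * adj z)" by (auto simp: Inn_def)
      have z': "unitary (adj z)" using z by (auto simp: unitary_def adj_adj)
      then have m: "(\<lambda>x. adj z * x * adj (adj z)) \<in> Inn" by (auto simp: Inn_def)
      have "inv\<^bsub>Aut\<^esub> a = (\<lambda>x. adj z * x * adj (adj z))"
      proof (rule group.inv_equality[OF group_Aut])
        show "(\<lambda>x. adj z * x * adj (adj z)) \<otimes>\<^bsub>Aut\<^esub> a = \<one>\<^bsub>Aut\<^esub>"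
          using z by (auto simp: Aut_def fun_eq_iff adj_adj unitary_def) (metis mult.assoc mult_1_right mult_1_left)
      qed (use sub m \<open>a \<in> Inn\<close> in auto)
      then show "inv\<^bsub>Aut\<^esub> a \<in> Inn" using m by simp
    next
      fix a b :: "'a \<Rightarrow> 'a" assume "a \<in> Inn" "b \<in> Inn"
      then obtain y z where z: "unitary z" "a = (\<lambda>x. z * x * adj z)" "unitary y" "b = (\<lambda>x. y * x * adj y)" by (auto simp: Inn_def)
      have "unitary (z * y)" using z(1,3) unfolding unitary_def adj_mult by (metis mult.assoc mult_1_right)
      then show "a \<otimes>\<^bsub>Aut\<^esub> b \<in> Inn" unfolding Inn_def
        by (auto simp: Aut_def z fun_eq_iff adj_mult mult.assoc intro!: exI[of _ "z*y"])
    qed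
  next
    fix x h :: "'a \<Rightarrow> 'a" assume x: "x \<in> carrier Aut" and "h \<in> Inn"
    then obtain z where z: "unitary z" "h = (\<lambda>x. z * x * adj z)" by (auto simp: Inn_def)
    have e: "unital_star_endomorphism x" using x by (simp add: Aut_def)
    have u: "unitary (x z)" using e z(1) unfolding unital_star_endomorphism_def unitary_def by metis
    have r: "x ((inv\<^bsub>Aut\<^esub> x) y) = y" for y using group.r_inv[OF group_Aut x] by (auto simp: Aut_def fun_eq_iff)
    have "x \<otimes>\<^bsub>Aut\<^esub> h \<otimes>\<^bsub>Aut\<^esub> inv\<^bsub>Aut\<^esub> x = (\<lambda>y. x z * y * adj (x z))"
      using e r by (auto simp: Aut_def z fun_eq_iff unital_star_endomorphism_def)
    then show "x \<otimes>\<^bsub>Aut\<^esub> h \<otimes>\<^bsub>Aut\<^esub> inv\<^bsub>Aut\<^esub> x \<in> Inn" using u by (auto simp: Inn_def)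
  qed
qed

definition Out :: "('a::unital_cstar_algebra \<Rightarrow> 'a) set monoid" where
  "Out = Aut Mod Inn"

definition out_class :: "('a::unital_cstar_algebra \<Rightarrow> 'a) \<Rightarrow> ('a \<Rightarrow> 'a) set" where
  "out_class \<phi> = Inn #>\<^bsub>Aut\<^esub> \<phi>"

lemma out_class_in_Out: "\<phi> \<in> carrier Aut \<Longrightarrow> out_class \<phi> \<in> carrier Out"
  by (auto simp: out_class_def Out_def FactGroup_def RCOSETS_def)

text \<open>
  By Cuntz's theorem the relations below determine the algebra up to isomorphism for \<open>n \<ge> 2\<close>, so
  \<open>cuntz_algebra n S\<close> says that the whole type \<open>'a\<close> is (a copy of) \<open>\<O>\<^sub>n\<close> with canonical generating
  isometries \<open>S 1, \<dots>, S n\<close>. Values of \<open>S\<close> outside \<open>{1..n}\<close> are irrelevant.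
\<close>

definition cuntz_algebra :: "nat \<Rightarrow> (nat \<Rightarrow> 'a::unital_cstar_algebra) \<Rightarrow> bool" where
  "cuntz_algebra n S \<longleftrightarrow> 2 \<le> n \<and>
     (\<forall>i\<in>{1..n}. adj (S i) * S i = 1) \<and>
     (\<Sum>i=1..n. S i * adj (S i)) = 1 \<and>
     unital_cstar_subalgebra hull (S ` {1..n}) = UNIV"

text \<open>
  \<open>is_lambda n S u \<phi>\<close>: \<open>\<phi>\<close> is the endomorphism \<open>\<lambda>\<^sub>u\<close>. A unital *-endomorphism is determined by its
  values on the generators.
\<close>

definition is_lambda ::
    "nat \<Rightarrow> (nat \<Rightarrow> 'a::unital_cstar_algebra) \<Rightarrow> 'a \<Rightarrow> ('a \<Rightarrow> 'a) \<Rightarrow> bool" where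
  "is_lambda n S u \<phi> \<longleftrightarrow>
     unital_star_endomorphism \<phi> \<and> (\<forall>i\<in>{1..n}. \<phi> (S i) = adj u * S i)"

definition words :: "nat \<Rightarrow> nat \<Rightarrow> nat list set" where
  "words n k = {\<alpha>. length \<alpha> = k \<and> set \<alpha> \<subseteq> {1..n}}"

definition S_word :: "(nat \<Rightarrow> 'a::monoid_mult) \<Rightarrow> nat list \<Rightarrow> 'a" where
  "S_word S \<alpha> = prod_list (map S \<alpha>)"

text \<open>\<open>perm_unitary n k S w \<sigma>\<close> is the relation \<open>w \<sim> \<sigma> \<in> P\<^sub>n\<^sup>k\<close>.\<close>

definition perm_unitary ::
    "nat \<Rightarrow> nat \<Rightarrow> (nat \<Rightarrow> 'a::unital_cstar_algebra) \<Rightarrow> 'a \<Rightarrow> (nat list \<Rightarrow> nat list) \<Rightarrow> bool" where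
  "perm_unitary n k S w \<sigma> \<longleftrightarrow> \<sigma> permutes words n k \<and>
     w = (\<Sum>\<alpha>\<in>words n k. S_word S (\<sigma> \<alpha>) * adj (S_word S \<alpha>))"

text \<open>
  The map \<open>f\<^sub>i\<^sup>w\<close> for \<open>w \<sim> \<sigma>\<close>. It depends on \<open>w\<close> only through \<open>\<sigma>\<close>, which is determined by \<open>w\<close>.
  For \<open>k \<ge> 1\<close> and \<open>\<alpha> \<in> words n (k - 1)\<close> the \<open>\<beta>\<close> in question exists and is unique.
\<close>

definition f_map ::
    "nat \<Rightarrow> nat \<Rightarrow> (nat list \<Rightarrow> nat list) \<Rightarrow> nat \<Rightarrow> nat list \<Rightarrow> nat list" where
  "f_map n k \<sigma> i \<alpha> =
     (THE \<beta>. \<beta> \<in> words n (k - 1) \<and> (\<exists>m\<in>{1..n}. i # \<alpha> = \<sigma> (\<beta> @ [m])))"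

definition f_tree ::
    "nat \<Rightarrow> nat \<Rightarrow> (nat list \<Rightarrow> nat list) \<Rightarrow> nat \<Rightarrow> (nat list, nat list \<times> nat list) pre_digraph" where
  "f_tree n k \<sigma> i = with_proj
     \<lparr> pverts = words n (k - 1),
       parcs = {(\<alpha>, f_map n k \<sigma> i \<alpha>) | \<alpha>. \<alpha> \<in> words n (k - 1) \<and> f_map n k \<sigma> i \<alpha> \<noteq> \<alpha>} \<rparr>"

lemma f_map_ex1: assumes "1 \<le> k" "\<sigma> permutes words n k" "i \<in> {1..n}" "\<alpha> \<in> words n (k-1)"
  shows "\<exists>!\<beta>. \<beta> \<in> words n (k - 1) \<and> (\<exists>m\<in>{1..n}. i # \<alpha> = \<sigma> (\<beta> @ [m]))"
proof -
  have "i # \<alpha> \<in> words n k" using assms by (auto simp: words_def)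
  then obtain g where g: "g \<in> words n k" "\<sigma> g = i # \<alpha>" using assms(2) by (metis permutes_image imageE)
  have inj: "\<And>a b. \<sigma> a = \<sigma> b \<Longrightarrow> a = b" using assms(2) permutes_inj by (metis injD)
  have "g \<noteq> []" using g assms by (auto simp: words_def)
  then obtain b m where gb: "g = b @ [m]" by (metis rev_exhaust)
  show ?thesis using g gb inj apply (intro ex1I[of _ b])
    subgoal using assms by (auto simp: words_def intro!: bexI[of _ m])
    subgoal for \<beta> by (smt (verit) append1_eq_conv)
    done
qed

lemma wf_digraph_f_tree: "1 \<le> k \<Longrightarrow> \<sigma> permutes words n k \<Longrightarrow> i \<in> {1..n} \<Longrightarrow> wf_digraph (f_tree n k \<sigma> i)"
  using theI'[OF f_map_ex1, of k \<sigma> n i] by unfold_locales (auto simp: f_tree_def f_map_def simp del: One_nat_def)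

end

theory Submission
  imports Defs "HOL-Analysis.Elementary_Normed_Spaces"
begin

text \<open>
  Suppose \<open>\<psi> = Ad z \<circ> \<phi>\<close> with \<open>z\<close> unitary. The plan is to show that \<open>z\<close> is, up to phases, a permutation of
  the words of length \<open>k - 1\<close>: \<open>z S\<^sub>\<alpha> = c\<^sub>\<alpha> S\<^bsub>h \<alpha>\<^esub>\<close> with \<open>h\<close> a bijection. Since \<open>\<phi> (S\<^sub>i) S\<^sub>\<alpha>\<close> is \<open>S\<^sub>\<beta> S\<^sub>l\<close>
  with \<open>\<beta>\<close> the image of \<open>\<alpha>\<close> under the \<open>i\<close>-th map of \<open>u\<close>, and likewise for \<open>\<psi>\<close> and \<open>w\<close>, the relation
  \<open>z \<phi> (S\<^sub>i) = \<psi> (S\<^sub>i) z\<close> then says that \<open>h\<close> conjugates one map into the other, so the two trees are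
  isomorphic for every \<open>i\<close>.

  The structure of \<open>z\<close> comes from three observations.

  \<^item> \<open>z\<close> is homogeneous. For integers \<open>d\<close> there is a contractive projection (\<open>deg_part\<close>) of \<open>\<O>\<^sub>n\<close> onto its
    part of degree \<open>d\<close>, where \<open>S\<^sub>\<alpha> S\<^sub>\<beta>\<^sup>*\<close> has degree \<open>\<bar>\<alpha>\<bar> - \<bar>\<beta>\<bar>\<close>. It is built by compressing with isometries,
    following Cuntz, so that neither the gauge action nor uniqueness of \<open>\<O>\<^sub>n\<close> has to be established.
    The generators \<open>\<phi> (S\<^sub>i)\<close> and \<open>\<psi> (S\<^sub>i)\<close> have degree one, so each part \<open>y\<close> of \<open>z\<close> intertwines \<open>\<phi>\<close> and
    \<open>\<psi>\<close> as well; then \<open>z\<^sup>* y\<close> commutes with the range of \<open>\<phi>\<close>, which is everything, and is a scalar. As some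
    part is nonzero, \<open>z\<close> is a multiple of it (\<open>deg_part_multiple\<close>).

  \<^item> \<open>z\<close> is a matrix over words of length \<open>k - 1\<close>. The identity \<open>\<psi> (S\<^sub>i)\<^sup>* y \<phi> (S\<^sub>i) = y\<close> rewrites a matrix
    coefficient \<open>S\<^sub>\<alpha>\<^sup>* y S\<^sub>\<beta>\<close> as the coefficient at longer and longer words, and far out every coefficient
    of a homogeneous element is nearly a scalar (\<open>deg_part_coefficient\<close>). A unitary \<open>n\<^sup>p \<times> n\<^sup>q\<close> matrix must
    be square, so the degree is \<open>0\<close> (\<open>z_scalar_coefficients\<close>).

  \<^item> \<open>z\<close> is monomial. Surjectivity of \<open>\<phi>\<close> gives \<open>S\<^sub>\<alpha> S\<^sub>\<alpha>\<^sup>* = \<phi> x\<close>; here \<open>x\<close> has degree \<open>0\<close>, so \<open>S\<^sub>\<mu>\<^sup>* x S\<^sub>\<mu>\<close> is nearly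
    scalar for long \<open>\<mu>\<close>, while its image under \<open>\<phi>\<close> is a projection that is diagonal in the words of length
    \<open>k - 1\<close>. So it is exactly \<open>0\<close> or \<open>1\<close>, the projection \<open>S\<^sub>\<alpha> S\<^sub>\<alpha>\<^sup>*\<close> is a combination of the range projections
    of the \<open>\<phi> (S\<^sub>\<mu>)\<close>, and \<open>z S\<^sub>\<alpha> S\<^sub>\<alpha>\<^sup>* z\<^sup>*\<close> is the same combination for \<open>\<psi>\<close>, hence diagonal
    (\<open>off_diagonal_zero\<close>). A column of \<open>z\<close> can then have only one nonzero entry.

  Two facts of C*-theory are needed: unital *-endomorphisms are contractive, and projections with sum
  \<open>1\<close> are mutually orthogonal. Both are derived from square roots of \<open>1 - a\<close> for \<open>\<parallel>a\<parallel> < 1\<close>, without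
  spectral theory.
\<close>

section \<open>Unital C*-algebras\<close>

lemma adj_zero [simp]: "adj (0::'a::unital_cstar_algebra) = 0"
  using adj_add[of "0::'a" 0] by simp

lemma adj_minus [simp]: "adj (- x) = - adj (x::'a::unital_cstar_algebra)"
  using adj_add[of x "- x"] by (simp add: eq_neg_iff_add_eq_0 add.commute)

lemma adj_diff: "adj (x - y) = adj x - adj (y::'a::unital_cstar_algebra)"
  using adj_add[of x "- y"] by simp

lemma adj_sum: "adj (\<Sum>i\<in>I. f i) = (\<Sum>i\<in>I. adj (f i :: 'a::unital_cstar_algebra))"
  by (induction I rule: infinite_finite_induct) (auto simp: adj_add)

lemma adj_power: "adj (x ^ m) = adj (x::'a::unital_cstar_algebra) ^ m"
  by (induction m) (auto simp: adj_one adj_mult power_commutes)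

lemma adj_scaleR: "adj (r *\<^sub>R x) = r *\<^sub>R adj (x::'a::unital_cstar_algebra)"
  using adj_scaleC[of "complex_of_real r" x] by (simp add: scaleC_of_real)

lemma scaleC_one [simp]: "scaleC 1 x = (x::'a::unital_cstar_algebra)"
  using scaleC_of_real[of 1 x] by simp

lemma scaleC_zero_left [simp]: "scaleC 0 x = (0::'a::unital_cstar_algebra)"
  using scaleC_of_real[of 0 x] by simp

lemma scaleC_zero_right [simp]: "scaleC c 0 = (0::'a::unital_cstar_algebra)"
  using scaleC_add_right[of c "0::'a" 0] by simp

lemma scaleC_minus_one: "scaleC (- 1) x = - (x::'a::unital_cstar_algebra)"
  using scaleC_of_real[of "- 1" x] by simp

lemma scaleC_diff_left: "scaleC (c - d) x = scaleC c x - scaleC d (x::'a::unital_cstar_algebra)"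
  using scaleC_add_left[of "c - d" d x] by (simp add: algebra_simps)

lemma scaleC_diff_right: "scaleC c (x - y) = scaleC c x - scaleC c (y::'a::unital_cstar_algebra)"
  using scaleC_add_right[of c "x - y" y] by (simp add: algebra_simps)

lemma scaleC_sum_left: "scaleC (\<Sum>i\<in>I. c i) x = (\<Sum>i\<in>I. scaleC (c i) (x::'a::unital_cstar_algebra))"
  by (induction I rule: infinite_finite_induct) (auto simp: scaleC_add_left)

lemma scaleC_eq_0_iff: "scaleC c x = 0 \<longleftrightarrow> c = 0 \<or> x = (0::'a::unital_cstar_algebra)"
  using norm_scaleC[of c x] by (metis mult_eq_0_iff norm_eq_zero)

lemma scaleC_eq_iff: "x \<noteq> 0 \<Longrightarrow> scaleC c x = scaleC d x \<longleftrightarrow> c = d" for x :: "'a::unital_cstar_algebra"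
  using scaleC_diff_left[of c d x] scaleC_eq_0_iff[of "c - d" x] by auto

lemma norm_adj [simp]: "norm (adj x) = norm (x::'a::unital_cstar_algebra)"
proof -
  have le: "norm y \<le> norm (adj y)" for y :: 'a
  proof (cases "norm y = 0")
    case False
    have "norm y * norm y \<le> norm (adj y) * norm y"
      using cstar_identity[of y] norm_mult_ineq[of "adj y" y] by (simp add: power2_eq_square)
    then show ?thesis using False by (simp add: mult_le_cancel_right)
  qed simp
  show ?thesis using le[of x] le[of "adj x"] by (simp add: adj_adj)
qed

lemma norm_isometry: "adj V * V = 1 \<Longrightarrow> norm V = 1" for V :: "'a::unital_cstar_algebra"
  using cstar_identity[of V] by (simp add: power2_eq_1_iff) (smt (verit) norm_ge_zero)

lemma norm_compression_le:
  fixes V W x :: "'a::unital_cstar_algebra"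
  assumes "adj V * V = 1" "adj W * W = 1"
  shows "norm (adj V * x * W) \<le> norm x"
proof -
  have "norm (adj V * x * W) \<le> norm (adj V) * norm x * norm W"
    by (rule order_trans[OF norm_mult_ineq mult_right_mono[OF norm_mult_ineq norm_ge_zero]])
  then show ?thesis using assms by (simp add: norm_isometry)
qed

lemma bounded_linear_adj: "bounded_linear (adj :: 'a::unital_cstar_algebra \<Rightarrow> 'a)"
  by (rule bounded_linear_intro[where K=1]) (auto simp: adj_add adj_scaleR)

lemma bounded_linear_scaleC: "bounded_linear (scaleC c :: 'a::unital_cstar_algebra \<Rightarrow> 'a)"
proof (rule bounded_linear_intro[where K="cmod c"])
  show "scaleC c (r *\<^sub>R x) = r *\<^sub>R scaleC c x" for r and x :: 'a
    using scaleC_scaleC[of c "complex_of_real r" x] scaleC_scaleC[of "complex_of_real r" c x]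
    by (simp add: scaleC_of_real mult.commute)
qed (auto simp: scaleC_add_right norm_scaleC mult.commute)

lemmas continuous_on_adj [continuous_intros] = bounded_linear.continuous_on[OF bounded_linear_adj]
lemmas continuous_on_scaleC [continuous_intros] = bounded_linear.continuous_on[OF bounded_linear_scaleC]
lemmas tendsto_adj [tendsto_intros] = bounded_linear.tendsto[OF bounded_linear_adj]
lemmas tendsto_scaleC [tendsto_intros] = bounded_linear.tendsto[OF bounded_linear_scaleC]

lemma closed_scalars: "closed (range (\<lambda>c. scaleC c (1::'a::unital_cstar_algebra)))"
  unfolding closed_sequential_limits
proof (intro allI impI, elim conjE)
  fix f :: "nat \<Rightarrow> 'a" and l
  assume f: "\<forall>m. f m \<in> range (\<lambda>c. scaleC c 1)" and l: "f \<longlonglongrightarrow> l"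
  from f have "\<forall>m. \<exists>c. f m = scaleC c 1" by auto
  then obtain c where c: "\<And>m. f m = scaleC (c m) 1" by metis
  have "dist (f i) (f j) = dist (c i) (c j)" for i j
    by (simp add: c dist_norm scaleC_diff_left[symmetric] norm_scaleC)
  then have "Cauchy c" using LIMSEQ_imp_Cauchy[OF l] by (simp add: Cauchy_def)
  then obtain d where d: "c \<longlonglongrightarrow> d" by (auto simp: Cauchy_convergent_iff convergent_def)
  have "(\<lambda>m. norm (c m - d)) \<longlonglongrightarrow> 0" using d by (simp add: LIM_zero tendsto_norm_zero)
  then have "(\<lambda>m. norm (f m - scaleC d 1)) \<longlonglongrightarrow> 0"
    by (simp add: c scaleC_diff_left[symmetric] norm_scaleC)
  then have "f \<longlonglongrightarrow> scaleC d 1" by (simp add: LIM_zero_iff tendsto_norm_zero_iff)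
  then show "l \<in> range (\<lambda>c. scaleC c 1)" using LIMSEQ_unique[OF l] by auto
qed

lemma scalar_if_near_scalars:
  fixes x :: "'a::unital_cstar_algebra"
  assumes "\<And>e. 0 < e \<Longrightarrow> \<exists>c. norm (x - scaleC c 1) < e"
  shows "\<exists>c. x = scaleC c 1"
proof -
  have "x \<in> closure (range (\<lambda>c. scaleC c 1))"
    using assms by (auto simp: closure_approachable dist_norm norm_minus_commute)
  then have "x \<in> range (\<lambda>c. scaleC c 1)" using closed_scalars closure_closed by blast
  then show ?thesis by auto
qed

text \<open>
  With \<open>s = 1 - t\<close> the equation \<open>s\<^sup>2 = 1 - a\<close> becomes the fixed point equation \<open>t = (a + t\<^sup>2) / 2\<close>, whose right-hand
  side is a contraction of a small ball. Self-adjointness and commutation properties pass to the fixed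
  point because they define a closed invariant subset of that ball.
\<close>

lemma sqrt_one_minus:
  fixes a :: "'a::unital_cstar_algebra"
  assumes a: "adj a = a" "norm a < 1"
  obtains s where "adj s = s" "s * s = 1 - a" "\<And>y. y * a = a * y \<Longrightarrow> y * s = s * y"
proof -
  \<comment> \<open>the smaller root of \<open>r = (\<parallel>a\<parallel> + r\<^sup>2) / 2\<close>; the map sends the ball of this radius into itself with Lipschitz constant \<open>r < 1\<close>\<close>
  define r where "r = 1 - sqrt (1 - norm a)"
  have r: "0 \<le> r" "r < 1" using a by (auto simp: r_def)
  have "(1 - r)\<^sup>2 = 1 - norm a" using a by (simp add: r_def)
  then have rr: "norm a + r * r = 2 * r" by (simp add: power2_eq_square algebra_simps)
  define T where "T t = (1/2) *\<^sub>R (a + t * t)" for t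
  define K where "K = {t. norm t \<le> r \<and> adj t = t \<and> (\<forall>y. y * a = a * y \<longrightarrow> y * t = t * y)}"
  have "closed K"
    unfolding K_def
    by (intro closed_Collect_conj closed_Collect_all closed_Collect_imp open_Collect_const
          closed_Collect_le closed_Collect_eq continuous_intros)
  then have "complete K" by (simp add: complete_eq_closed)
  moreover have "0 \<in> K" using r by (simp add: K_def)
  moreover have "T ` K \<subseteq> K"
  proof (rule image_subsetI)
    fix t assume "t \<in> K"
    then have t: "norm t \<le> r" "adj t = t" and comm: "\<And>y. y * a = a * y \<Longrightarrow> y * t = t * y"
      unfolding K_def by blast+
    have "norm (t * t) \<le> r * r"
      using norm_mult_ineq[of t t] mult_mono[OF t(1) t(1)] r by (simp add: order_trans)
    then have "norm (T t) \<le> r" using norm_triangle_ineq[of a "t * t"] rr by (simp add: T_def)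
    moreover have "adj (T t) = T t" using a t by (simp add: T_def adj_scaleR adj_add adj_mult)
    moreover have "y * T t = T t * y" if y: "y * a = a * y" for y
    proof -
      have "y * (t * t) = t * t * y" using comm[OF y] by (metis mult.assoc)
      then show ?thesis using y by (simp add: T_def distrib_left distrib_right)
    qed
    ultimately show "T t \<in> K" unfolding K_def by blast
  qed
  moreover have "dist (T t) (T t') \<le> r * dist t t'" if "t \<in> K" "t' \<in> K" for t t'
  proof -
    have "T t - T t' = (1/2) *\<^sub>R (t * (t - t') + (t - t') * t')"
      by (simp add: T_def algebra_simps)
    then have "norm (T t - T t') \<le> (1/2) * (norm t * norm (t - t') + norm (t - t') * norm t')"
      using norm_triangle_ineq[of "t * (t - t')" "(t - t') * t'"]
        norm_mult_ineq[of t "t - t'"] norm_mult_ineq[of "t - t'" t'] by simp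
    also have "\<dots> \<le> (1/2) * (r * norm (t - t') + norm (t - t') * r)"
      using that by (intro mult_left_mono add_mono mult_right_mono) (auto simp: K_def)
    finally show ?thesis by (simp add: dist_norm)
  qed
  ultimately obtain t where t: "t \<in> K" "T t = t"
    using Banach_fix[of K r T] r by auto
  show thesis
  proof (rule that[of "1 - t"])
    show "adj (1 - t) = 1 - t" using t by (simp add: K_def adj_diff adj_one)
    have "2 *\<^sub>R T t = a + t * t" by (simp add: T_def)
    then have "2 *\<^sub>R t = a + t * t" by (simp only: t(2))
    then show "(1 - t) * (1 - t) = 1 - a" by (simp add: algebra_simps scaleR_2)
    show "y * (1 - t) = (1 - t) * y" if "y * a = a * y" for y
      using t that by (auto simp: K_def algebra_simps)
  qed
qed

lemma adj_selfadjoint_plus_i: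
  fixes x y :: "'a::unital_cstar_algebra"
  assumes "adj x = x" "adj y = y" "x * y = y * x"
  shows "adj (x + scaleC \<i> y) * (x + scaleC \<i> y) = x * x + y * y"
proof -
  have "scaleC (-\<i>) y = - scaleC \<i> y"
    using scaleC_diff_left[of 0 "\<i>" y] by simp
  then show ?thesis
    using assms
    by (simp add: adj_add adj_scaleC algebra_simps mult_scaleC_left mult_scaleC_right scaleC_scaleC
        scaleC_minus_one scaleC_add_right scaleC_diff_right)
qed

text \<open>
  A self-adjoint \<open>h\<close> with \<open>\<parallel>h\<parallel> < 1\<close> is the mean of the unitary \<open>h + i (1 - h\<^sup>2)\<^bsup>1/2\<^esup>\<close> and its adjoint. A unital
  *-endomorphism sends unitaries to unitaries, so it maps such an \<open>h\<close> into the unit ball; the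
  C*-identity reduces the general case to this one.
\<close>

lemma unital_star_endomorphism_contractive:
  fixes \<phi> :: "'a::unital_cstar_algebra \<Rightarrow> 'a"
  assumes "unital_star_endomorphism \<phi>"
  shows "norm (\<phi> x) \<le> norm x"
proof -
  have add: "\<phi> (x + y) = \<phi> x + \<phi> y" and mult: "\<phi> (x * y) = \<phi> x * \<phi> y"
    and sc: "\<phi> (scaleC c x) = scaleC c (\<phi> x)" and ad: "\<phi> (adj x) = adj (\<phi> x)"
    and one: "\<phi> 1 = 1" for x y c
    using assms by (auto simp: unital_star_endomorphism_def)
  have scR: "\<phi> (r *\<^sub>R x) = r *\<^sub>R \<phi> x" for r x
    using sc[of "complex_of_real r" x] by (simp add: scaleC_of_real)
  have small: "norm (\<phi> h) \<le> 1" if h: "adj h = h" "norm h < 1" for h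
  proof -
    have "norm (h * h) < 1" using cstar_identity[of h] h by (simp add: power_less_one_iff)
    moreover have "adj (h * h) = h * h" using h by (simp add: adj_mult)
    ultimately obtain s where s: "adj s = s" "s * s = 1 - h * h"
      and s_comm: "\<And>y. y * (h * h) = h * h * y \<Longrightarrow> y * s = s * y"
      using sqrt_one_minus by blast
    have hs: "h * s = s * h" by (rule s_comm) (simp add: mult.assoc)
    define U where "U = h + scaleC \<i> s"
    have "adj U * U = 1" unfolding U_def
      using adj_selfadjoint_plus_i[OF h(1) s(1) hs] s by simp
    then have "adj (\<phi> U) * \<phi> U = 1" by (simp flip: ad mult add: one)
    then have "norm (\<phi> U) = 1" by (rule norm_isometry)
    moreover have "2 *\<^sub>R h = U + adj U"
      using scaleC_diff_left[of 0 "\<i>" s] h s by (simp add: U_def adj_add adj_scaleC scaleR_2)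
    then have "\<phi> (2 *\<^sub>R h) = \<phi> (U + adj U)" by (rule arg_cong)
    then have "2 *\<^sub>R \<phi> h = \<phi> U + adj (\<phi> U)" by (simp only: scR add ad)
    ultimately have "norm (2 *\<^sub>R \<phi> h) \<le> 2"
      using norm_triangle_ineq[of "\<phi> U" "adj (\<phi> U)"] by simp
    then show ?thesis by simp
  qed
  have sa: "norm (\<phi> h) \<le> norm h" if h: "adj h = h" for h
  proof (rule dense_ge)
    fix r assume r: "norm h < r"
    then have "r > 0" using norm_ge_zero[of h] by linarith
    then have "norm (\<phi> ((1/r) *\<^sub>R h)) \<le> 1" using r h by (intro small) (auto simp: adj_scaleR)
    then show "norm (\<phi> h) \<le> r" using \<open>r > 0\<close> by (simp add: scR field_simps)
  qed
  have "(norm (\<phi> x))\<^sup>2 = norm (\<phi> (adj x * x))" by (simp add: cstar_identity mult ad)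
  also have "\<dots> \<le> norm (adj x * x)" by (rule sa) (simp add: adj_mult adj_adj)
  finally show ?thesis by (simp add: cstar_identity power2_le_iff_abs_le)
qed

lemma unital_star_endomorphism_bounded_linear:
  fixes \<phi> :: "'a::unital_cstar_algebra \<Rightarrow> 'a"
  assumes "unital_star_endomorphism \<phi>"
  shows "bounded_linear \<phi>"
proof (rule bounded_linear_intro[where K=1])
  show "\<phi> (r *\<^sub>R x) = r *\<^sub>R \<phi> x" for r x
    using assms scaleC_of_real[of r] by (metis unital_star_endomorphism_def)
qed (use assms unital_star_endomorphism_contractive in \<open>auto simp: unital_star_endomorphism_def\<close>)

lemma norm_selfadjoint_power:
  fixes z :: "'a::unital_cstar_algebra"
  assumes "adj z = z"
  shows "norm (z ^ (2 ^ m)) = norm z ^ (2 ^ m)"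
proof (induction m)
  case (Suc m)
  have "z ^ (2 ^ Suc m) = adj (z ^ (2 ^ m)) * z ^ (2 ^ m)"
    using assms by (simp add: adj_power power_add[symmetric] mult_2)
  then show ?case using Suc by (simp add: cstar_identity power_mult[symmetric] mult.commute)
qed simp

text \<open>
  High powers decide: \<open>(x + y)\<^sup>N = x\<^sup>N + y\<^sup>N\<close> has norm at most \<open>2\<close> for all \<open>N = 2\<^sup>m\<close>, and for these \<open>N\<close> the norm of
  the power is the power of the norm.
\<close>

lemma norm_orthogonal_sum_le_one:
  fixes x y :: "'a::unital_cstar_algebra"
  assumes sa: "adj x = x" "adj y = y" and orth: "x * y = 0" "y * x = 0"
    and le: "norm x \<le> 1" "norm y \<le> 1"
  shows "norm (x + y) \<le> 1"
proof (rule ccontr)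
  assume "\<not> norm (x + y) \<le> 1"
  then obtain N where N: "2 < norm (x + y) ^ N" using real_arch_pow by force
  have pow: "(x + y) ^ Suc j = x ^ Suc j + y ^ Suc j" for j
  proof (induction j)
    case (Suc j)
    have "x * y ^ Suc j = 0" "y * x ^ Suc j = 0" using orth by (simp_all add: mult.assoc[symmetric])
    then show ?case using Suc by (simp add: algebra_simps)
  qed simp
  obtain j where j: "2 ^ N = Suc j" by (metis not0_implies_Suc power_not_zero zero_neq_numeral)
  have "norm ((x + y) ^ (2 ^ N)) \<le> norm (x ^ (2 ^ N)) + norm (y ^ (2 ^ N))"
    unfolding j pow by (rule norm_triangle_ineq)
  also have "\<dots> \<le> 1 + 1"
    using le by (intro add_mono) (auto simp: norm_selfadjoint_power sa power_le_one)
  finally have "norm (x + y) ^ (2 ^ N) \<le> 2" using sa by (simp add: norm_selfadjoint_power adj_add)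
  moreover have "norm (x + y) ^ N \<le> norm (x + y) ^ (2 ^ N)"
    using \<open>\<not> norm (x + y) \<le> 1\<close> by (intro power_increasing) (auto intro: less_imp_le)
  ultimately show False using N by simp
qed

text \<open>
  The two hypotheses say that \<open>h\<close> and \<open>- h\<close> are positive. After a perturbation of size \<open>e\<close> both get commuting
  self-adjoint square roots \<open>x\<close> and \<open>y\<close>, suitably scaled, and \<open>x\<^sup>2 + M y\<^sup>2\<close> is a scalar of order \<open>e\<close>. It equals
  \<open>v\<^sup>* v\<close> for \<open>v = x + i M\<^bsup>1/2\<^esup> y\<close>, so \<open>v\<close>, its real part \<open>x\<close> and finally \<open>h\<close> are small.
\<close>

lemma selfadjoint_eq_zero_if_both_signs:
  fixes h :: "'a::unital_cstar_algebra"
  assumes h: "adj h = h" "norm (1 - h) \<le> 1" and M: "norm (of_real M + h) \<le> M" "0 < M"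
  shows "h = 0"
proof -
  have bound: "(1 - e) * norm h \<le> e * (M + 2)" if e: "0 < e" "e < 1" for e
  proof -
    define a where "a = (1 - e) *\<^sub>R (1 - h)"
    define b where "b = (1 - e) *\<^sub>R (1 + (1/M) *\<^sub>R h)"
    have "(1 - e) * norm (1 - h) \<le> (1 - e) * 1" using h e by (intro mult_left_mono) auto
    moreover have "norm a = (1 - e) * norm (1 - h)" using e by (simp add: a_def)
    ultimately have "norm a \<le> 1 - e" by simp
    then have na: "norm a < 1" using e by simp
    have "1 + (1/M) *\<^sub>R h = (1/M) *\<^sub>R (of_real M + h)"
      using M by (simp add: scaleR_add_right of_real_def)
    then have "norm (1 + (1/M) *\<^sub>R h) \<le> 1" using M by simp
    then have "(1 - e) * norm (1 + (1/M) *\<^sub>R h) \<le> (1 - e) * 1" using e by (intro mult_left_mono) auto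
    moreover have "norm b = (1 - e) * norm (1 + (1/M) *\<^sub>R h)" using e by (simp add: b_def)
    ultimately have "norm b \<le> 1 - e" by simp
    then have nb: "norm b < 1" using e by simp
    have sa: "adj a = a" "adj b = b" using h by (auto simp: a_def b_def adj_scaleR adj_add adj_diff adj_one)
    have ab: "a * b = b * a" by (simp add: a_def b_def algebra_simps)
    obtain x where x: "adj x = x" "x * x = 1 - a" "\<And>y. y * a = a * y \<Longrightarrow> y * x = x * y"
      using sqrt_one_minus[OF sa(1) na] by blast
    obtain y where y: "adj y = y" "y * y = 1 - b" "\<And>x. x * b = b * x \<Longrightarrow> x * y = y * x"
      using sqrt_one_minus[OF sa(2) nb] by blast
    have xy: "x * y = y * x" using x(3)[of b] y(3)[of x] ab by metis
    define v where "v = x + scaleC \<i> (sqrt M *\<^sub>R y)"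
    have "adj v * v = x * x + M *\<^sub>R (y * y)"
    proof -
      have "adj (sqrt M *\<^sub>R y) = sqrt M *\<^sub>R y" by (simp add: adj_scaleR y(1))
      moreover have "x * (sqrt M *\<^sub>R y) = (sqrt M *\<^sub>R y) * x" by (simp add: xy)
      ultimately have "adj v * v = x * x + (sqrt M *\<^sub>R y) * (sqrt M *\<^sub>R y)"
        unfolding v_def by (rule adj_selfadjoint_plus_i[OF x(1)])
      then show ?thesis using M by simp
    qed
    also have "\<dots> = (e * (M + 1)) *\<^sub>R 1"
    proof -
      have "M *\<^sub>R (1 - b) = (M * e) *\<^sub>R 1 - (1 - e) *\<^sub>R h"
      proof -
        have "M *\<^sub>R b = (M * (1 - e)) *\<^sub>R 1 + (1 - e) *\<^sub>R h"
          using M by (simp add: b_def scaleR_add_right)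
        then show ?thesis by (simp add: scaleR_diff_right) (simp add: algebra_simps)
      qed
      then show ?thesis unfolding x(2) y(2) by (simp add: a_def algebra_simps)
    qed
    finally have nv: "(norm v)\<^sup>2 = e * (M + 1)"
      using e M cstar_identity[of v] by simp
    have "2 *\<^sub>R x = v + adj v"
      using scaleC_diff_left[of 0 "\<i>" "sqrt M *\<^sub>R y"] x(1) y(1)
      by (simp add: v_def adj_add adj_scaleC adj_scaleR scaleR_2)
    then have "norm (2 *\<^sub>R x) = norm (v + adj v)" by (rule arg_cong)
    then have "norm x \<le> norm v" using norm_triangle_ineq[of v "adj v"] by simp
    then have "(norm x)\<^sup>2 \<le> (norm v)\<^sup>2" by (intro power_mono) auto
    then have "norm (x * x) \<le> e * (M + 1)" using cstar_identity[of x] x(1) nv by simp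
    moreover have "(1 - e) *\<^sub>R h = x * x - e *\<^sub>R 1" unfolding x(2) by (simp add: a_def algebra_simps)
    ultimately have "norm ((1 - e) *\<^sub>R h) \<le> e * (M + 1) + e"
      using norm_triangle_ineq4[of "x * x" "e *\<^sub>R 1"] e by simp
    then have "(1 - e) * norm h \<le> e * (M + 1) + e" using e by simp
    then show ?thesis by (simp add: algebra_simps)
  qed
  have "((\<lambda>e. (1 - e) * norm h) \<longlongrightarrow> (1 - 0) * norm h) (at_right 0)" by (intro tendsto_intros)
  moreover have "((\<lambda>e. e * (M + 2)) \<longlongrightarrow> 0 * (M + 2)) (at_right (0::real))" by (intro tendsto_intros)
  moreover have "eventually (\<lambda>e. (1 - e) * norm h \<le> e * (M + 2)) (at_right (0::real))"
    using bound eventually_at_right_real[of 0 1] by (auto elim!: eventually_mono)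
  ultimately have "(1 - 0) * norm h \<le> 0 * (M + 2)" by (intro tendsto_le[OF trivial_limit_at_right_real])
  then show ?thesis by simp
qed

text \<open>
  Compressing the sum by \<open>P j\<close> shows that the elements \<open>P j P l P j\<close> with \<open>l \<noteq> j\<close> add up to \<open>0\<close>. Each of them is
  positive in the sense \<open>\<parallel>1 - h\<parallel> \<le> 1\<close>, so each is also the negative of a sum of positive elements and
  must vanish.
\<close>

lemma projections_sum_one_orthogonal:
  fixes P :: "'i \<Rightarrow> 'a::unital_cstar_algebra"
  assumes I: "finite I" "i \<in> I" "j \<in> I" "i \<noteq> j"
    and P: "\<And>l. l \<in> I \<Longrightarrow> adj (P l) = P l" "\<And>l. l \<in> I \<Longrightarrow> P l * P l = P l"
    and sum: "(\<Sum>l\<in>I. P l) = 1"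
  shows "P i * P j = 0"
proof -
  define h where "h l = P j * P l * P j" for l
  define J where "J = I - {j}"
  have norm_le: "norm (1 - h l) \<le> 1" if l: "l \<in> J" for l
  proof -
    have PP: "P j * P j = P j" "P l * P l = P l" "adj (P j) = P j" "adj (P l) = P l"
      using P I l by (auto simp: J_def)
    have j0: "P j * (P j * y) = P j * y" for y by (metis PP(1) mult.assoc)
    have unit_le: "norm q \<le> 1" if q: "adj q = q" "q * q = q" for q :: 'a
    proof -
      have "(norm q)\<^sup>2 = norm q" using cstar_identity[of q] q by simp
      then have "norm q = 0 \<or> norm q = 1" by (simp add: power2_eq_square)
      then show ?thesis by auto
    qed
    have n1: "norm (1 - P j) \<le> 1" "norm (P j) \<le> 1" "norm (1 - P l) \<le> 1"
      using PP by (intro unit_le; simp add: adj_diff adj_one algebra_simps)+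
    have "norm (P j * (1 - P l) * P j) \<le> norm (P j) * norm (1 - P l) * norm (P j)"
      by (rule order_trans[OF norm_mult_ineq mult_right_mono[OF norm_mult_ineq norm_ge_zero]])
    also have "\<dots> \<le> 1" using n1 by (simp add: mult_le_one)
    finally have "norm (P j * (1 - P l) * P j) \<le> 1" .
    then have "norm ((1 - P j) + P j * (1 - P l) * P j) \<le> 1"
      using n1 PP by (intro norm_orthogonal_sum_le_one)
        (simp_all add: adj_diff adj_one adj_mult algebra_simps j0)
    moreover have "(1 - P j) + P j * (1 - P l) * P j = 1 - h l"
      using PP by (simp add: h_def algebra_simps)
    ultimately show ?thesis by simp
  qed
  have finJ: "finite J" "i \<in> J" using I by (auto simp: J_def)
  have "(\<Sum>l\<in>I. h l) = P j * (\<Sum>l\<in>I. P l) * P j"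
    by (simp add: h_def sum_distrib_left sum_distrib_right)
  also have "\<dots> = P j" using P I sum by simp
  finally have "(\<Sum>l\<in>I. h l) = P j" .
  moreover have "(\<Sum>l\<in>I. h l) = h j + (\<Sum>l\<in>J. h l)"
    unfolding J_def by (rule sum.remove) (use I in auto)
  moreover have "h j = P j" using P I by (simp add: h_def)
  ultimately have hJ: "(\<Sum>l\<in>J. h l) = 0" by simp
  define J' where "J' = J - {i}"
  define M where "M = real (card J')"
  have hi: "h i = - (\<Sum>l\<in>J'. h l)"
    using hJ finJ by (simp add: J'_def sum.remove[of J i] eq_neg_iff_add_eq_0)
  have "of_real M + h i = (\<Sum>l\<in>J'. 1 - h l)"
    by (simp add: hi sum_subtractf M_def)
  then have "norm (of_real M + h i) \<le> M"
    using sum_norm_le[of J' "\<lambda>l. 1 - h l" "\<lambda>_. 1"] norm_le by (simp add: M_def J'_def)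
  then have "norm (of_real (M + 1) + h i) \<le> M + 1"
    using norm_triangle_ineq[of "of_real M + h i" 1] by (simp add: algebra_simps)
  then have "h i = 0"
    using norm_le[OF finJ(2)] P I
    by (intro selfadjoint_eq_zero_if_both_signs[of _ "M + 1"])
      (auto simp: h_def adj_mult mult.assoc M_def)
  \<comment> \<open>\<open>P j P i P j = (P i P j)\<^sup>* (P i P j)\<close>, so the C*-identity applies\<close>
  then have "adj (P i * P j) * (P i * P j) = 0"
    using P I by (simp add: h_def adj_mult) (metis mult.assoc)
  then show ?thesis using cstar_identity[of "P i * P j"] by simp
qed

section \<open>Words in the Cuntz isometries\<close>

(* letters are the elements of {1..n}; rewriting 1 to Suc 0 would break matching of this set *)
declare One_nat_def [simp del]

lemma words_Suc: "words n (Suc k) = (\<lambda>(i, \<alpha>). i # \<alpha>) ` ({1..n} \<times> words n k)"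
  by (auto simp: words_def image_iff length_Suc_conv)

lemma words_0 [simp]: "words n 0 = {[]}"
  by (auto simp: words_def)

lemma finite_words [simp]: "finite (words n k)"
  by (induction k) (auto simp: words_Suc)

lemma card_words: "card (words n k) = n ^ k"
proof (induction k)
  case (Suc k)
  have "inj_on (\<lambda>(i, \<alpha>). i # \<alpha>) ({1..n} \<times> words n k)" by (auto simp: inj_on_def)
  then show ?case using Suc by (simp add: words_Suc card_image card_cartesian_product)
qed simp

locale cuntz =
  fixes n :: nat and S :: "nat \<Rightarrow> 'a::unital_cstar_algebra"
  assumes cuntz: "cuntz_algebra n S"
begin

abbreviation Sw :: "nat list \<Rightarrow> 'a" where "Sw \<alpha> \<equiv> S_word S \<alpha>"

lemma n_ge_2: "2 \<le> n"
  using cuntz by (simp add: cuntz_algebra_def)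

lemma sum_ranges: "(\<Sum>i=1..n. S i * adj (S i)) = 1"
  using cuntz by (simp add: cuntz_algebra_def)

text \<open>
  The relations only say that the range projections add up to \<open>1\<close>; orthogonality of the ranges is the
  general fact on projections proved above.
\<close>

lemma adj_S_mult_S:
  assumes "i \<in> {1..n}" "j \<in> {1..n}"
  shows "adj (S i) * S j = (if i = j then 1 else 0)"
proof (cases "i = j")
  case False
  have iso: "adj (S l) * S l = 1" if "l \<in> {1..n}" for l
    using cuntz that by (simp add: cuntz_algebra_def)
  have "(S i * adj (S i)) * (S j * adj (S j)) = 0"
  proof (rule projections_sum_one_orthogonal[OF _ assms False])
    fix l assume l: "l \<in> {1..n}"
    show "S l * adj (S l) * (S l * adj (S l)) = S l * adj (S l)"
      using iso[OF l] by (metis mult.assoc mult_1_right)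
  qed (simp_all add: adj_mult adj_adj sum_ranges[simplified])
  then have "adj (S i) * ((S i * adj (S i)) * (S j * adj (S j))) * S j = 0" by simp
  then have "(adj (S i) * S i) * (adj (S i) * S j) * (adj (S j) * S j) = 0"
    by (simp only: mult.assoc)
  then show ?thesis using False iso assms by simp
qed (use cuntz assms in \<open>simp add: cuntz_algebra_def\<close>)

lemma Sw_Nil [simp]: "Sw [] = 1"
  by (simp add: S_word_def)

lemma Sw_Cons [simp]: "Sw (i # \<alpha>) = S i * Sw \<alpha>"
  by (simp add: S_word_def)

lemma Sw_append: "Sw (\<alpha> @ \<beta>) = Sw \<alpha> * Sw \<beta>"
  by (simp add: S_word_def)

lemma adj_Sw_mult_Sw:
  assumes "set \<alpha> \<subseteq> {1..n}" "set \<beta> \<subseteq> {1..n}" "length \<alpha> = length \<beta>"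
  shows "adj (Sw \<alpha>) * Sw \<beta> = (if \<alpha> = \<beta> then 1 else 0)"
  using assms(3,1,2)
proof (induction \<alpha> \<beta> rule: list_induct2)
  case (Cons i \<alpha> j \<beta>)
  have "adj (Sw (i # \<alpha>)) * Sw (j # \<beta>) = adj (Sw \<alpha>) * (adj (S i) * S j) * Sw \<beta>"
    by (simp add: adj_mult mult.assoc)
  then show ?case using Cons adj_S_mult_S[of i j] by auto
qed (simp add: adj_one)

lemma Sw_isometry: "set \<alpha> \<subseteq> {1..n} \<Longrightarrow> adj (Sw \<alpha>) * Sw \<alpha> = 1"
  by (simp add: adj_Sw_mult_Sw)

lemma Sw_nonzero: "set \<alpha> \<subseteq> {1..n} \<Longrightarrow> Sw \<alpha> \<noteq> 0"
  using Sw_isometry[of \<alpha>] by auto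

lemma adj_Sw_mult_longer:
  assumes "set \<alpha> \<subseteq> {1..n}" "set \<beta> \<subseteq> {1..n}" "length \<alpha> \<le> length \<beta>"
  shows "adj (Sw \<alpha>) * Sw \<beta> = (if take (length \<alpha>) \<beta> = \<alpha> then Sw (drop (length \<alpha>) \<beta>) else 0)"
proof -
  have "adj (Sw \<alpha>) * Sw \<beta> = adj (Sw \<alpha>) * Sw (take (length \<alpha>) \<beta>) * Sw (drop (length \<alpha>) \<beta>)"
    by (metis Sw_append append_take_drop_id mult.assoc)
  moreover have "set (take (length \<alpha>) \<beta>) \<subseteq> {1..n}" using assms set_take_subset by fast
  ultimately show ?thesis using assms by (auto simp: adj_Sw_mult_Sw)
qed

lemma adj_Sw_mult_shorter:
  assumes "set \<alpha> \<subseteq> {1..n}" "set \<beta> \<subseteq> {1..n}" "length \<beta> \<le> length \<alpha>"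
  shows "adj (Sw \<alpha>) * Sw \<beta> = (if take (length \<beta>) \<alpha> = \<beta> then adj (Sw (drop (length \<beta>) \<alpha>)) else 0)"
proof -
  have "adj (Sw \<alpha>) * Sw \<beta> = adj (adj (Sw \<beta>) * Sw \<alpha>)" by (simp add: adj_mult adj_adj)
  then show ?thesis using adj_Sw_mult_longer[of \<beta> \<alpha>] assms by simp
qed

lemma sum_word_ranges: "(\<Sum>\<alpha>\<in>words n k. Sw \<alpha> * adj (Sw \<alpha>)) = 1"
proof (induction k)
  case (Suc k)
  have "inj_on (\<lambda>(i, \<alpha>). i # \<alpha>) ({1..n} \<times> words n k)" by (auto simp: inj_on_def)
  then have "(\<Sum>\<alpha>\<in>words n (Suc k). Sw \<alpha> * adj (Sw \<alpha>))
      = (\<Sum>(i, \<alpha>)\<in>{1..n} \<times> words n k. S i * (Sw \<alpha> * adj (Sw \<alpha>)) * adj (S i))"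
    unfolding words_Suc
    by (subst sum.reindex) (auto simp: adj_mult mult.assoc intro!: sum.cong)
  also have "\<dots> = (\<Sum>i=1..n. S i * (\<Sum>\<alpha>\<in>words n k. Sw \<alpha> * adj (Sw \<alpha>)) * adj (S i))"
    by (simp add: sum.cartesian_product[symmetric] sum_distrib_left sum_distrib_right)
  finally show ?case using Suc sum_ranges by simp
qed (simp add: adj_one)

lemma eq_if_eq_on_Sw:
  assumes "\<And>\<alpha>. \<alpha> \<in> words n k \<Longrightarrow> x * Sw \<alpha> = y * Sw \<alpha>"
  shows "x = y"
proof -
  have "x * (Sw \<alpha> * adj (Sw \<alpha>)) = y * (Sw \<alpha> * adj (Sw \<alpha>))" if "\<alpha> \<in> words n k" for \<alpha>
    using assms[OF that] by (metis mult.assoc)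
  then have "x * (\<Sum>\<alpha>\<in>words n k. Sw \<alpha> * adj (Sw \<alpha>)) = y * (\<Sum>\<alpha>\<in>words n k. Sw \<alpha> * adj (Sw \<alpha>))"
    by (simp add: sum_distrib_left)
  then show ?thesis by (simp add: sum_word_ranges)
qed

text \<open>
  The dense *-algebra of combinations of \<open>S\<^sub>\<alpha> S\<^sub>\<beta>\<^sup>*\<close>, on which degrees can be read off.
\<close>

inductive_set alg :: "'a set" where
  monomial: "set \<alpha> \<subseteq> {1..n} \<Longrightarrow> set \<beta> \<subseteq> {1..n} \<Longrightarrow> Sw \<alpha> * adj (Sw \<beta>) \<in> alg"
| add: "x \<in> alg \<Longrightarrow> y \<in> alg \<Longrightarrow> x + y \<in> alg"
| scale: "x \<in> alg \<Longrightarrow> scaleC c x \<in> alg"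

lemma zero_alg: "0 \<in> alg"
  using alg.scale[OF alg.monomial[of "[]" "[]"], of 0] by simp

lemma adj_alg: "x \<in> alg \<Longrightarrow> adj x \<in> alg"
  by (induction rule: alg.induct)
    (auto simp: adj_add adj_scaleC adj_mult adj_adj intro: alg.intros)

lemma mult_alg:
  assumes "x \<in> alg" "y \<in> alg"
  shows "x * y \<in> alg"
  using assms(1)
proof induction
  case (monomial \<alpha> \<beta>)
  show ?case using assms(2)
  proof induction
    case (monomial \<gamma> \<delta>)
    have *: "Sw \<alpha> * adj (Sw \<beta>) * (Sw \<gamma> * adj (Sw \<delta>)) = Sw \<alpha> * (adj (Sw \<beta>) * Sw \<gamma>) * adj (Sw \<delta>)"
      by (simp only: mult.assoc)
    show ?case
    proof (cases "length \<beta> \<le> length \<gamma>")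
      case True
      have "Sw \<alpha> * (adj (Sw \<beta>) * Sw \<gamma>) * adj (Sw \<delta>)
          = (if take (length \<beta>) \<gamma> = \<beta> then Sw (\<alpha> @ drop (length \<beta>) \<gamma>) * adj (Sw \<delta>) else 0)"
        using adj_Sw_mult_longer[OF _ _ True] monomial \<open>set \<beta> \<subseteq> {1..n}\<close> by (simp add: Sw_append)
      moreover have "set (\<alpha> @ drop (length \<beta>) \<gamma>) \<subseteq> {1..n}"
        using monomial \<open>set \<alpha> \<subseteq> {1..n}\<close> set_drop_subset by fastforce
      ultimately show ?thesis using monomial unfolding * by (simp add: alg.monomial zero_alg)
    next
      case False
      have "Sw \<alpha> * (adj (Sw \<beta>) * Sw \<gamma>) * adj (Sw \<delta>)
          = (if take (length \<gamma>) \<beta> = \<gamma> then Sw \<alpha> * adj (Sw (\<delta> @ drop (length \<gamma>) \<beta>)) else 0)"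
        using adj_Sw_mult_shorter[of \<beta> \<gamma>] False monomial \<open>set \<beta> \<subseteq> {1..n}\<close>
        by (simp add: Sw_append adj_mult mult.assoc)
      moreover have "set (\<delta> @ drop (length \<gamma>) \<beta>) \<subseteq> {1..n}"
        using monomial \<open>set \<beta> \<subseteq> {1..n}\<close> set_drop_subset by fastforce
      ultimately show ?thesis using \<open>set \<alpha> \<subseteq> {1..n}\<close> unfolding * by (simp add: alg.monomial zero_alg)
    qed
  qed (auto simp: distrib_left mult_scaleC_right intro: alg.intros)
qed (auto simp: distrib_right mult_scaleC_left intro: alg.intros)

lemma closure_alg: "closure alg = UNIV"
proof -
  have "unital_cstar_subalgebra (closure alg)"
    unfolding unital_cstar_subalgebra_def
  proof (intro conjI ballI allI)
    show "1 \<in> closure alg"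
      using alg.monomial[of "[]" "[]"] closure_subset[of alg] by (auto simp: adj_one)
    fix x assume "x \<in> closure alg"
    then obtain f where f: "\<And>i. f i \<in> alg" "f \<longlonglongrightarrow> x" by (auto simp: closure_sequential)
    show "adj x \<in> closure alg"
      unfolding closure_sequential
      by (intro exI[of _ "\<lambda>i. adj (f i)"] conjI allI tendsto_intros adj_alg f)
    show "scaleC c x \<in> closure alg" for c
      unfolding closure_sequential
      by (intro exI[of _ "\<lambda>i. scaleC c (f i)"] conjI allI tendsto_intros alg.scale f)
    fix y assume "y \<in> closure alg"
    then obtain g where g: "\<And>i. g i \<in> alg" "g \<longlonglongrightarrow> y" by (auto simp: closure_sequential)
    show "x + y \<in> closure alg"
      unfolding closure_sequential
      by (intro exI[of _ "\<lambda>i. f i + g i"] conjI allI tendsto_intros alg.add f g)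
    show "x * y \<in> closure alg"
      unfolding closure_sequential
      by (intro exI[of _ "\<lambda>i. f i * g i"] conjI allI tendsto_intros mult_alg f g)
  qed simp
  moreover have "S ` {1..n} \<subseteq> closure alg"
  proof
    fix x assume "x \<in> S ` {1..n}"
    then obtain i where "i \<in> {1..n}" "x = S i" by auto
    then have "x \<in> alg" using alg.monomial[of "[i]" "[]"] by (simp add: adj_one)
    then show "x \<in> closure alg" using closure_subset by blast
  qed
  ultimately have "unital_cstar_subalgebra hull (S ` {1..n}) \<subseteq> closure alg"
    by (intro hull_minimal)
  then show ?thesis using cuntz by (auto simp: cuntz_algebra_def)
qed

text \<open>
  Identities between continuous linear maps need only be checked on the elements \<open>S\<^sub>\<alpha> S\<^sub>\<beta>\<^sup>*\<close>.
\<close>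

lemma dense_induct [consumes 0, case_names closed add scale monomial]:
  assumes "closed {x. P x}"
    and "\<And>x y. P x \<Longrightarrow> P y \<Longrightarrow> P (x + y)"
    and "\<And>c x. P x \<Longrightarrow> P (scaleC c x)"
    and "\<And>\<alpha> \<beta>. set \<alpha> \<subseteq> {1..n} \<Longrightarrow> set \<beta> \<subseteq> {1..n} \<Longrightarrow> P (Sw \<alpha> * adj (Sw \<beta>))"
  shows "P x"
proof -
  have "P y" if "y \<in> alg" for y using that by induction (use assms in auto)
  then have "closure alg \<subseteq> {x. P x}" using assms(1) by (intro closure_minimal) auto
  then show ?thesis by (auto simp: closure_alg)
qed

lemma approx_alg:
  assumes "0 < e"
  obtains y where "y \<in> alg" "norm (x - y) < e"
  using closure_approachableD[of x alg e] assms by (auto simp: closure_alg dist_norm)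

section \<open>The canonical endomorphism\<close>

definition shift :: "'a \<Rightarrow> 'a" where
  "shift x = (\<Sum>i=1..n. S i * x * adj (S i))"

lemma shift_mult_S: "i \<in> {1..n} \<Longrightarrow> shift x * S i = S i * x"
proof -
  assume i: "i \<in> {1..n}"
  have "shift x * S i = (\<Sum>j=1..n. S j * x * (adj (S j) * S i))"
    by (simp add: shift_def sum_distrib_right mult.assoc)
  also have "\<dots> = (\<Sum>j=1..n. if j = i then S i * x else 0)"
    using i by (intro sum.cong) (simp_all add: adj_S_mult_S)
  finally show ?thesis using i by simp
qed

lemma adj_S_mult_shift: "i \<in> {1..n} \<Longrightarrow> adj (S i) * shift x = x * adj (S i)"
proof -
  assume i: "i \<in> {1..n}"
  have "adj (S i) * shift x = (\<Sum>j=1..n. (adj (S i) * S j) * x * adj (S j))"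
    by (simp add: shift_def sum_distrib_left mult.assoc)
  also have "\<dots> = (\<Sum>j=1..n. if j = i then x * adj (S i) else 0)"
    using i by (intro sum.cong) (auto simp: adj_S_mult_S)
  finally show ?thesis using i by simp
qed

lemma shift_mult: "shift (x * y) = shift x * shift y"
proof (rule eq_if_eq_on_Sw[of "Suc 0"])
  fix \<alpha> assume "\<alpha> \<in> words n (Suc 0)"
  then obtain i where "\<alpha> = [i]" "i \<in> {1..n}" by (auto simp: words_Suc)
  then show "shift (x * y) * Sw \<alpha> = shift x * shift y * Sw \<alpha>"
    using shift_mult_S[of i] by (simp add: mult.assoc) (metis mult.assoc)
qed

lemma adj_shift: "adj (shift x) = shift (adj x)"
  by (simp add: shift_def adj_sum adj_mult adj_adj mult.assoc)

lemma shift_one: "shift 1 = 1"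
  by (simp add: shift_def sum_ranges[simplified])

lemma shift_zero: "shift 0 = 0"
  by (simp add: shift_def)

lemma shifts_mult: "(shift ^^ m) (x * y) = (shift ^^ m) x * (shift ^^ m) y"
  by (induction m) (auto simp: shift_mult)

lemma adj_shifts: "adj ((shift ^^ m) x) = (shift ^^ m) (adj x)"
  by (induction m) (auto simp: adj_shift)

lemma shifts_one [simp]: "(shift ^^ m) 1 = 1"
  by (induction m) (auto simp: shift_one)

lemma shifts_zero [simp]: "(shift ^^ m) 0 = 0"
  by (induction m) (auto simp: shift_zero)

text \<open>
  Elements in the range of a high power of \<open>shift\<close> slide past words, losing one power for each letter. In
  particular they commute with \<open>S\<^sub>\<alpha> S\<^sub>\<beta>\<^sup>*\<close> for \<open>\<bar>\<alpha>\<bar> = \<bar>\<beta>\<bar>\<close> up to that power.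
\<close>

lemma shifts_mult_Sw:
  "set \<alpha> \<subseteq> {1..n} \<Longrightarrow> (shift ^^ (m + length \<alpha>)) x * Sw \<alpha> = Sw \<alpha> * (shift ^^ m) x"
proof (induction \<alpha>)
  case (Cons i \<alpha>)
  have "(shift ^^ (m + length (i # \<alpha>))) x * Sw (i # \<alpha>) = shift ((shift ^^ (m + length \<alpha>)) x) * S i * Sw \<alpha>"
    by (simp add: mult.assoc)
  also have "\<dots> = S i * ((shift ^^ (m + length \<alpha>)) x * Sw \<alpha>)"
    using Cons by (simp add: shift_mult_S mult.assoc)
  finally show ?case using Cons by (simp add: mult.assoc)
qed simp

text \<open>
  An algebraic form of "\<open>V\<close> is homogeneous of degree \<open>d\<close>". The bound \<open>m\<close> leaves room for elements such as
  \<open>u\<^sup>* S\<^sub>i\<close>, which obey the rule only once the power of \<open>shift\<close> exceeds the length of the words that \<open>u\<close>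
  permutes.
\<close>

definition raises :: "nat \<Rightarrow> 'a \<Rightarrow> bool" where
  "raises d V \<longleftrightarrow> (\<exists>m. \<forall>M\<ge>m. \<forall>x. V * (shift ^^ M) x = (shift ^^ (M + d)) x * V)"

lemma raises_one: "raises 0 1"
  by (auto simp: raises_def)

lemma raises_mult:
  assumes "raises d V" "raises e W"
  shows "raises (d + e) (V * W)"
proof -
  obtain m m' where m: "\<And>M x. m \<le> M \<Longrightarrow> V * (shift ^^ M) x = (shift ^^ (M + d)) x * V"
    and m': "\<And>M x. m' \<le> M \<Longrightarrow> W * (shift ^^ M) x = (shift ^^ (M + e)) x * W"
    using assms unfolding raises_def by metis
  have "V * W * (shift ^^ M) x = (shift ^^ (M + (d + e))) x * (V * W)" if "max m m' \<le> M" for M x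
  proof -
    have "V * W * (shift ^^ M) x = V * (shift ^^ (M + e)) x * W" using m'[of M x] that by (simp add: mult.assoc)
    also have "\<dots> = (shift ^^ (M + e + d)) x * (V * W)" using m[of "M + e" x] that by (simp add: mult.assoc)
    finally show ?thesis by (simp add: ac_simps)
  qed
  then show ?thesis unfolding raises_def by blast
qed

lemma raises_S: "i \<in> {1..n} \<Longrightarrow> raises 1 (S i)"
  unfolding raises_def by (auto simp: shift_mult_S simp flip: Suc_eq_plus1)

lemma raises_S_word:
  assumes "\<And>i. i \<in> {1..n} \<Longrightarrow> raises 1 (V i)" and "set \<alpha> \<subseteq> {1..n}"
  shows "raises (length \<alpha>) (S_word V \<alpha>)"
  using assms(2)
proof (induction \<alpha>)
  case (Cons i \<alpha>)
  then show ?case using raises_mult[OF assms(1)[of i], of "length \<alpha>"] by (simp add: S_word_def plus_1_eq_Suc)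
qed (simp add: S_word_def raises_one)

section \<open>Homogeneous parts\<close>

text \<open>
  The word \<open>1\<^sup>D 2\<close> does not overlap a shifted copy of itself. Therefore different powers of \<open>shift\<close> move the
  isometry \<open>probe D\<close> to isometries with orthogonal ranges, as long as the powers differ by at most \<open>D\<close>
  (\<open>shifted_probes\<close>), and compressing by such pairs tells degrees apart.
\<close>

definition probe :: "nat \<Rightarrow> 'a" where
  "probe D = S 1 ^ D * S 2"

lemma letters_1_2: "1 \<in> {1..n}" "2 \<in> {1..n}" "Suc 0 \<in> {1..n}"
  using n_ge_2 by auto

lemma S1_power: "S 1 ^ D = Sw (replicate D 1)"
  by (induction D) auto

lemma adj_S1_power_mult: "adj (S 1 ^ D) * S 1 ^ D = 1"
  unfolding S1_power using letters_1_2 by (intro Sw_isometry) auto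

lemma probe_isometry: "adj (probe D) * probe D = 1"
proof -
  have "adj (probe D) * probe D = adj (S 2) * (adj (S 1 ^ D) * S 1 ^ D) * S 2"
    by (simp only: probe_def adj_mult mult.assoc)
  then show ?thesis using adj_S_mult_S[OF letters_1_2(2,2)] by (simp add: adj_S1_power_mult del: One_nat_def)
qed

lemma adj_S1_power_mult_shifts: "adj (S 1 ^ e) * (shift ^^ e) x = x * adj (S 1 ^ e)"
proof (induction e)
  case (Suc e)
  have "adj (S 1 ^ Suc e) * (shift ^^ Suc e) x = adj (S 1 ^ e) * (adj (S 1) * shift ((shift ^^ e) x))"
    by (simp add: power_commutes adj_mult mult.assoc del: One_nat_def)
  also have "\<dots> = adj (S 1 ^ e) * (shift ^^ e) x * adj (S 1)"
    using adj_S_mult_shift[OF letters_1_2(1)] by (simp add: mult.assoc)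
  also have "\<dots> = x * adj (S 1 ^ Suc e)"
    unfolding Suc by (simp add: adj_mult mult.assoc)
  finally show ?case .
qed (simp add: adj_one)

lemma probe_separates:
  assumes "1 \<le> e" "e \<le> D"
  shows "adj (probe D) * (shift ^^ e) (probe D) = 0"
proof -
  have split: "S 1 ^ D = S 1 ^ (D - e) * S 1 ^ e" "S 1 ^ D = S 1 ^ e * S 1 ^ (D - e)"
    using assms by (simp_all add: power_add[symmetric] del: One_nat_def)
  have e1: "S 1 ^ e = S 1 * S 1 ^ (e - 1)" using assms by (metis Suc_diff_1 less_eq_Suc_le One_nat_def power_Suc)
  have "adj (probe D) * (shift ^^ e) (probe D)
      = adj (S 2) * adj (S 1 ^ (D - e)) * (adj (S 1 ^ e) * (shift ^^ e) (probe D))"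
    by (subst probe_def, subst split(2)) (simp only: adj_mult mult.assoc)
  also have "\<dots> = adj (S 2) * adj (S 1 ^ (D - e)) * (S 1 ^ (D - e) * S 1 ^ e * S 2) * adj (S 1 ^ e)"
    unfolding adj_S1_power_mult_shifts by (subst probe_def, subst split(1)) (simp only: mult.assoc)
  also have "\<dots> = adj (S 2) * (adj (S 1 ^ (D - e)) * S 1 ^ (D - e)) * (S 1 ^ e * S 2 * adj (S 1 ^ e))"
    by (simp only: mult.assoc)
  also have "\<dots> = (adj (S 2) * S 1) * (S 1 ^ (e - 1) * S 2 * adj (S 1 ^ e))"
    unfolding adj_S1_power_mult by (subst (1) e1) (simp only: mult.assoc mult_1_right)
  also have "\<dots> = 0" using adj_S_mult_S[OF letters_1_2(2,1)] by (simp del: One_nat_def)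
  finally show ?thesis .
qed

lemma shifted_probes:
  assumes "a \<le> b + D" "b \<le> a + D"
  shows "adj ((shift ^^ a) (probe D)) * (shift ^^ b) (probe D) = (if a = b then 1 else 0)"
proof -
  consider "a = b" | "a < b" | "b < a" by linarith
  then show ?thesis
  proof cases
    case 1
    then show ?thesis by (simp add: adj_shifts shifts_mult[symmetric] probe_isometry)
  next
    case 2
    then have b: "(shift ^^ b) x = (shift ^^ a) ((shift ^^ (b - a)) x)" for x
      by (metis funpow_add comp_apply le_add_diff_inverse less_imp_le)
    show ?thesis using 2 assms
      by (simp add: adj_shifts b shifts_mult[symmetric] probe_separates)
  next
    case 3
    then have b: "(shift ^^ a) x = (shift ^^ b) ((shift ^^ (a - b)) x)" for x
      by (metis funpow_add comp_apply le_add_diff_inverse less_imp_le)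
    have "adj (adj (probe D) * (shift ^^ (a - b)) (probe D)) = 0"
      using 3 assms by (simp add: probe_separates)
    then have "adj ((shift ^^ (a - b)) (probe D)) * probe D = 0" by (simp add: adj_mult adj_adj)
    then show ?thesis using 3 assms
      by (simp add: adj_shifts b shifts_mult[symmetric])
  qed
qed

text \<open>
  On \<open>S\<^sub>\<alpha> S\<^sub>\<beta>\<^sup>*\<close> the outer isometries slide inwards and meet in the middle with powers of \<open>shift\<close> that agree
  exactly if \<open>\<bar>\<alpha>\<bar> - \<bar>\<beta>\<bar> = p - q\<close>. So for large \<open>N\<close> the compression keeps the terms of degree \<open>p - q\<close> and kills the
  others. Two indices are used so that negative degrees need no separate treatment.
\<close>

definition compress :: "nat \<Rightarrow> nat \<Rightarrow> nat \<Rightarrow> 'a \<Rightarrow> 'a" where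
  "compress p q N x = adj ((shift ^^ (N + p)) (probe N)) * x * (shift ^^ (N + q)) (probe N)"

text \<open>
  The Fourier coefficient of degree \<open>p - q\<close> for the gauge action. Only the difference of \<open>p\<close> and \<open>q\<close> matters
  (\<open>deg_part_diagonal_invariant\<close>).
\<close>

definition deg_part :: "nat \<Rightarrow> nat \<Rightarrow> 'a \<Rightarrow> 'a" where
  "deg_part p q x = lim (\<lambda>N. compress p q N x)"

lemma norm_compress_le: "norm (compress p q N x) \<le> norm x"
  unfolding compress_def by (intro norm_compression_le) (simp_all add: shifted_probes)

lemma compress_add: "compress p q N (x + y) = compress p q N x + compress p q N y"
  by (simp add: compress_def algebra_simps)

lemma compress_diff: "compress p q N (x - y) = compress p q N x - compress p q N y"
  by (simp add: compress_def algebra_simps)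

lemma compress_scaleC: "compress p q N (scaleC c x) = scaleC c (compress p q N x)"
  by (simp add: compress_def mult_scaleC_left mult_scaleC_right)

lemma compress_monomial:
  assumes \<alpha>: "set \<alpha> \<subseteq> {1..n}" "set \<beta> \<subseteq> {1..n}" and N: "length \<alpha> + length \<beta> + p + q \<le> N"
  shows "compress p q N (Sw \<alpha> * adj (Sw \<beta>))
    = (if length \<alpha> + q = length \<beta> + p then Sw \<alpha> * adj (Sw \<beta>) else 0)"
proof -
  define a b where "a = N + p - length \<alpha>" and "b = N + q - length \<beta>"
  have ab: "N + p = a + length \<alpha>" "N + q = b + length \<beta>" using N by (auto simp: a_def b_def)
  define g where "g = probe N"
  have l: "adj ((shift ^^ (a + length \<alpha>)) g) * Sw \<alpha> = Sw \<alpha> * adj ((shift ^^ a) g)"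
    using \<alpha> by (simp add: adj_shifts shifts_mult_Sw)
  have "adj (adj ((shift ^^ (b + length \<beta>)) g) * Sw \<beta>) = adj (Sw \<beta> * adj ((shift ^^ b) g))"
    using \<alpha> by (simp add: adj_shifts shifts_mult_Sw)
  then have r: "adj (Sw \<beta>) * (shift ^^ (b + length \<beta>)) g = (shift ^^ b) g * adj (Sw \<beta>)"
    by (simp add: adj_mult adj_adj)
  have "compress p q N (Sw \<alpha> * adj (Sw \<beta>))
      = (adj ((shift ^^ (a + length \<alpha>)) g) * Sw \<alpha>) * (adj (Sw \<beta>) * (shift ^^ (b + length \<beta>)) g)"
    by (simp only: compress_def ab g_def mult.assoc)
  also have "\<dots> = Sw \<alpha> * (adj ((shift ^^ a) g) * (shift ^^ b) g) * adj (Sw \<beta>)"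
    by (simp only: l r mult.assoc)
  also have "\<dots> = (if a = b then Sw \<alpha> * adj (Sw \<beta>) else 0)"
    unfolding g_def using N by (subst shifted_probes) (auto simp: a_def b_def)
  also have "a = b \<longleftrightarrow> length \<alpha> + q = length \<beta> + p" using N by (auto simp: a_def b_def)
  finally show ?thesis .
qed

text \<open>
  The compressions are uniformly bounded and eventually constant on \<open>alg\<close>, hence convergent on its closure.
\<close>

lemma convergent_compress: "convergent (\<lambda>N. compress p q N x)"
proof (induction x rule: dense_induct)
  case closed
  show ?case unfolding closed_sequential_limits
  proof (intro allI impI, elim conjE)
    fix f l assume f: "\<forall>i. f i \<in> {x. convergent (\<lambda>N. compress p q N x)}" and l: "f \<longlonglongrightarrow> l"
    have "Cauchy (\<lambda>N. compress p q N l)"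
    proof (rule metric_CauchyI)
      fix e :: real assume e: "0 < e"
      then obtain i where i: "norm (f i - l) < e / 3"
        using l by (metis LIMSEQ_iff divide_pos_pos order_refl zero_less_numeral)
      have "Cauchy (\<lambda>N. compress p q N (f i))" using f by (simp add: convergent_Cauchy)
      then obtain M where M: "\<And>N N'. M \<le> N \<Longrightarrow> M \<le> N' \<Longrightarrow> dist (compress p q N (f i)) (compress p q N' (f i)) < e / 3"
        using e by (metis metric_CauchyD divide_pos_pos zero_less_numeral)
      have "dist (compress p q N l) (compress p q N' l) < e" if "M \<le> N" "M \<le> N'" for N N'
      proof -
        have c: "dist (compress p q N (f i)) (compress p q N l) < e / 3" for N
          using norm_compress_le[of p q N "f i - l"] i by (simp add: compress_diff dist_norm)
        show ?thesis
          using M[OF that] c[of N] c[of N'] dist_commute[of "compress p q N (f i)" "compress p q N l"]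
            dist_triangle[of "compress p q N l" "compress p q N' l" "compress p q N (f i)"]
            dist_triangle[of "compress p q N (f i)" "compress p q N' l" "compress p q N' (f i)"]
          by linarith
      qed
      then show "\<exists>M. \<forall>N\<ge>M. \<forall>N'\<ge>M. dist (compress p q N l) (compress p q N' l) < e" by blast
    qed
    then show "l \<in> {x. convergent (\<lambda>N. compress p q N x)}" by (simp add: Cauchy_convergent)
  qed
next
  case (add x y)
  then show ?case by (simp add: compress_add convergent_add)
next
  case (scale c x)
  then obtain l where "(\<lambda>N. compress p q N x) \<longlonglongrightarrow> l" by (auto simp: convergent_def)
  then have "(\<lambda>N. scaleC c (compress p q N x)) \<longlonglongrightarrow> scaleC c l" by (intro tendsto_intros)
  then show ?case by (auto simp: compress_scaleC convergent_def)
next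
  case (monomial \<alpha> \<beta>)
  have "eventually (\<lambda>N. compress p q N (Sw \<alpha> * adj (Sw \<beta>))
      = (if length \<alpha> + q = length \<beta> + p then Sw \<alpha> * adj (Sw \<beta>) else 0)) sequentially"
    using compress_monomial[OF monomial] eventually_ge_at_top by (rule eventually_mono[rotated])
  then have "(\<lambda>N. compress p q N (Sw \<alpha> * adj (Sw \<beta>))) \<longlonglongrightarrow>
      (if length \<alpha> + q = length \<beta> + p then Sw \<alpha> * adj (Sw \<beta>) else 0)" by (rule tendsto_eventually)
  then show ?case unfolding convergent_def by (rule exI)
qed

lemma deg_part_lim: "(\<lambda>N. compress p q N x) \<longlonglongrightarrow> deg_part p q x"
  using convergent_compress unfolding deg_part_def by (simp add: convergent_LIMSEQ_iff)

lemma deg_partI: "(\<lambda>N. compress p q N x) \<longlonglongrightarrow> y \<Longrightarrow> deg_part p q x = y"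
  using deg_part_lim LIMSEQ_unique by blast

lemma deg_part_monomial:
  assumes "set \<alpha> \<subseteq> {1..n}" "set \<beta> \<subseteq> {1..n}"
  shows "deg_part p q (Sw \<alpha> * adj (Sw \<beta>)) = (if length \<alpha> + q = length \<beta> + p then Sw \<alpha> * adj (Sw \<beta>) else 0)"
  using compress_monomial[OF assms] eventually_ge_at_top
  by (intro deg_partI tendsto_eventually) (rule eventually_mono[rotated])

lemma deg_part_one: "deg_part p q 1 = (if p = q then 1 else 0)"
  using deg_part_monomial[of "[]" "[]" p q] by (auto simp: adj_one)

lemma deg_part_add: "deg_part p q (x + y) = deg_part p q x + deg_part p q y"
  by (rule deg_partI) (simp add: compress_add tendsto_add deg_part_lim)

lemma deg_part_scaleC: "deg_part p q (scaleC c x) = scaleC c (deg_part p q x)"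
  by (rule deg_partI) (simp add: compress_scaleC tendsto_scaleC deg_part_lim)

lemma deg_part_zero [simp]: "deg_part p q 0 = 0"
  using deg_part_scaleC[of p q 0 0] by simp

lemma deg_part_diff: "deg_part p q (x - y) = deg_part p q x - deg_part p q y"
  by (rule deg_partI) (simp add: compress_diff tendsto_diff deg_part_lim)

lemma norm_deg_part_le: "norm (deg_part p q x) \<le> norm x"
  by (rule tendsto_upperbound[OF tendsto_norm[OF deg_part_lim]]) (simp_all add: norm_compress_le)

lemma bounded_linear_deg_part: "bounded_linear (deg_part p q)"
proof (rule bounded_linear_intro[where K=1])
  show "deg_part p q (r *\<^sub>R x) = r *\<^sub>R deg_part p q x" for r x
    using deg_part_scaleC[of p q "complex_of_real r" x] by (simp add: scaleC_of_real)
qed (simp_all add: deg_part_add norm_deg_part_le)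

lemmas continuous_on_deg_part [continuous_intros] = bounded_linear.continuous_on[OF bounded_linear_deg_part]

lemma deg_part_Suc_Suc: "deg_part (Suc p) (Suc q) x = deg_part p q x"
proof (induction x rule: dense_induct)
  case closed
  show ?case by (intro closed_Collect_eq continuous_intros)
qed (auto simp: deg_part_add deg_part_scaleC deg_part_monomial)

lemma deg_part_diagonal_invariant: "deg_part (j + p) (j + q) x = deg_part p q x"
  by (induction j) (auto simp: deg_part_Suc_Suc)

text \<open>
  Degrees add. The four variants put \<open>V\<close> or its adjoint on either side.
\<close>

lemma deg_part_raise_left:
  assumes "raises d V"
  shows "deg_part (d + p) q (V * x) = V * deg_part p q x"
proof (rule deg_partI)
  obtain m where m: "\<And>M x. m \<le> M \<Longrightarrow> V * (shift ^^ M) x = (shift ^^ (M + d)) x * V"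
    using assms unfolding raises_def by blast
  have eq: "compress (d + p) q N (V * x) = V * compress p q N x" if "m \<le> N" for N
  proof -
    have "adj ((shift ^^ (N + (d + p))) (probe N)) * V = V * adj ((shift ^^ (N + p)) (probe N))"
      using m[of "N + p" "adj (probe N)"] that by (simp add: adj_shifts add.commute add.left_commute)
    then show ?thesis by (simp add: compress_def mult.assoc[symmetric])
  qed
  have "eventually (\<lambda>N. V * compress p q N x = compress (d + p) q N (V * x)) sequentially"
    using eventually_ge_at_top[of m] by (rule eventually_mono) (simp add: eq)
  with tendsto_mult_left[OF deg_part_lim] show "(\<lambda>N. compress (d + p) q N (V * x)) \<longlonglongrightarrow> V * deg_part p q x"
    by (rule Lim_transform_eventually)
qed

lemma deg_part_raise_right:
  assumes "raises d V"
  shows "deg_part p q (x * V) = deg_part p (d + q) x * V"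
proof (rule deg_partI)
  obtain m where m: "\<And>M x. m \<le> M \<Longrightarrow> V * (shift ^^ M) x = (shift ^^ (M + d)) x * V"
    using assms unfolding raises_def by blast
  have eq: "compress p q N (x * V) = compress p (d + q) N x * V" if "m \<le> N" for N
  proof -
    have "V * (shift ^^ (N + q)) (probe N) = (shift ^^ (N + (d + q))) (probe N) * V"
      using m[of "N + q" "probe N"] that by (simp add: add.commute add.left_commute)
    then show ?thesis by (simp add: compress_def mult.assoc)
  qed
  have "eventually (\<lambda>N. compress p (d + q) N x * V = compress p q N (x * V)) sequentially"
    using eventually_ge_at_top[of m] by (rule eventually_mono) (simp add: eq)
  with tendsto_mult_right[OF deg_part_lim] show "(\<lambda>N. compress p q N (x * V)) \<longlonglongrightarrow> deg_part p (d + q) x * V"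
    by (rule Lim_transform_eventually)
qed

lemma adj_deg_part: "adj (deg_part p q x) = deg_part q p (adj x)"
proof -
  have "compress q p N (adj x) = adj (compress p q N x)" for N
    by (simp add: compress_def adj_mult adj_adj mult.assoc)
  then show ?thesis using tendsto_adj[OF deg_part_lim] by (intro deg_partI[symmetric]) simp
qed

lemma deg_part_raise_adj_left:
  assumes "raises d V"
  shows "deg_part p q (adj V * x) = adj V * deg_part (d + p) q x"
proof -
  have "adj (deg_part q p (adj x * V)) = adj (deg_part q (d + p) (adj x) * V)"
    by (simp add: deg_part_raise_right[OF assms])
  then show ?thesis by (simp add: adj_deg_part adj_mult adj_adj)
qed

lemma deg_part_raise_adj_right:
  assumes "raises d V"
  shows "deg_part p (d + q) (x * adj V) = deg_part p q x * adj V"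
proof -
  have "adj (deg_part (d + q) p (V * adj x)) = adj (V * deg_part q p (adj x))"
    by (simp add: deg_part_raise_left[OF assms])
  then show ?thesis by (simp add: adj_deg_part adj_mult adj_adj)
qed

text \<open>
  If all parts of \<open>z\<close> vanished, then so would the degree \<open>0\<close> part of \<open>y\<^sup>* z\<close> for \<open>y\<close> in \<open>alg\<close>, and by density
  that of \<open>z\<^sup>* z = 1\<close>. Every degree is represented by a pair with prescribed minimum.
\<close>

lemma deg_part_nonzero:
  assumes z: "unitary z"
  shows "\<exists>p q. min p q = m \<and> deg_part p q z \<noteq> 0"
proof (rule ccontr)
  assume "\<nexists>p q. min p q = m \<and> deg_part p q z \<noteq> 0"
  then have zero: "deg_part p q z = 0" if "min p q = m" for p q using that by blast
  have zero': "deg_part p q z = 0" for p q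
  proof (cases "m \<le> min p q")
    case True
    have "deg_part (p - (min p q - m)) (q - (min p q - m)) z = 0" using True by (intro zero) auto
    then show ?thesis
      using True deg_part_diagonal_invariant[of "min p q - m" "p - (min p q - m)" "q - (min p q - m)" z] by simp
  next
    case False
    then have "deg_part ((m - min p q) + p) ((m - min p q) + q) z = 0" by (intro zero) auto
    then show ?thesis by (simp only: deg_part_diagonal_invariant)
  qed
  have "deg_part 0 0 (adj y * z) = 0" for y
  proof (induction y rule: dense_induct)
    case closed
    show ?case by (intro closed_Collect_eq continuous_intros)
  next
    case (monomial \<alpha> \<beta>)
    have "deg_part 0 0 (adj (Sw \<alpha> * adj (Sw \<beta>)) * z)
        = deg_part (length \<beta> + 0) (length \<beta> + 0) (Sw \<beta> * (adj (Sw \<alpha>) * z))"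
      unfolding deg_part_diagonal_invariant by (simp add: adj_mult adj_adj mult.assoc)
    also have "\<dots> = Sw \<beta> * deg_part 0 (length \<beta> + 0) (adj (Sw \<alpha>) * z)"
      using monomial by (intro deg_part_raise_left raises_S_word raises_S)
    also have "\<dots> = Sw \<beta> * (adj (Sw \<alpha>) * deg_part (length \<alpha> + 0) (length \<beta> + 0) z)"
      using monomial by (subst deg_part_raise_adj_left[OF raises_S_word[OF raises_S]]) auto
    finally show ?case by (simp add: zero')
  qed (auto simp: adj_add adj_scaleC distrib_right mult_scaleC_left deg_part_add deg_part_scaleC)
  from this[of z] show False using z by (simp add: unitary_def deg_part_one)
qed

text \<open>
  For \<open>y\<close> in \<open>alg\<close> the coefficients of the degree \<open>p - q\<close> part at long words are exactly scalars: all words occurring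
  in \<open>y\<close> are absorbed, and what remains is \<open>S\<^sub>a\<^sup>* S\<^sub>b\<close> with \<open>\<bar>a\<bar> = \<bar>b\<bar>\<close>. A general element is approximated from \<open>alg\<close>.
\<close>

lemma deg_part_asymptotically_scalar:
  assumes "0 < e"
  shows "\<exists>r0. \<forall>r\<ge>r0. \<forall>\<alpha>\<in>words n (p + r). \<forall>\<beta>\<in>words n (q + r).
    \<exists>c. norm (adj (Sw \<alpha>) * deg_part p q x * Sw \<beta> - scaleC c 1) < e"
proof -
  have exact: "\<exists>r0. \<forall>r\<ge>r0. \<forall>\<alpha>\<in>words n (p + r). \<forall>\<beta>\<in>words n (q + r).
    \<exists>c. adj (Sw \<alpha>) * deg_part p q y * Sw \<beta> = scaleC c 1" if "y \<in> alg" for y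
    using that
  proof induction
    case (monomial \<gamma> \<delta>)
    have "\<exists>c. adj (Sw \<alpha>) * deg_part p q (Sw \<gamma> * adj (Sw \<delta>)) * Sw \<beta> = scaleC c 1"
      if r: "length \<gamma> + length \<delta> \<le> r" and \<alpha>: "\<alpha> \<in> words n (p + r)" and \<beta>: "\<beta> \<in> words n (q + r)" for r \<alpha> \<beta>
    proof (cases "length \<gamma> + q = length \<delta> + p")
      case True
      define a b where "a = drop (length \<gamma>) \<alpha>" and "b = drop (length \<delta>) \<beta>"
      have ab: "set a \<subseteq> {1..n}" "set b \<subseteq> {1..n}" "length a = length b"
        using \<alpha> \<beta> r True set_drop_subset[of "length \<gamma>" \<alpha>] set_drop_subset[of "length \<delta>" \<beta>]
        by (auto simp: words_def a_def b_def)
      have eq: "adj (Sw \<alpha>) * deg_part p q (Sw \<gamma> * adj (Sw \<delta>)) * Sw \<beta>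
          = (adj (Sw \<alpha>) * Sw \<gamma>) * (adj (Sw \<delta>) * Sw \<beta>)"
        using monomial True by (simp add: deg_part_monomial mult.assoc)
      have l: "adj (Sw \<alpha>) * Sw \<gamma> \<in> {0, adj (Sw a)}"
        using adj_Sw_mult_shorter[of \<alpha> \<gamma>] monomial \<alpha> r by (auto simp: words_def a_def)
      have r: "adj (Sw \<delta>) * Sw \<beta> \<in> {0, Sw b}"
        using adj_Sw_mult_longer[of \<delta> \<beta>] monomial \<beta> r by (auto simp: words_def b_def)
      have "(adj (Sw \<alpha>) * Sw \<gamma>) * (adj (Sw \<delta>) * Sw \<beta>) \<in> {scaleC 0 1, scaleC 1 1}"
        using l r adj_Sw_mult_Sw[OF ab] by auto
      then show ?thesis unfolding eq by blast
    next
      case False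
      then show ?thesis using monomial by (intro exI[of _ 0]) (simp add: deg_part_monomial)
    qed
    then show ?case by blast
  next
    case (add x y)
    then obtain r0 r1 where r0: "\<And>r \<alpha> \<beta>. r0 \<le> r \<Longrightarrow> \<alpha> \<in> words n (p + r) \<Longrightarrow> \<beta> \<in> words n (q + r) \<Longrightarrow>
        \<exists>c. adj (Sw \<alpha>) * deg_part p q x * Sw \<beta> = scaleC c 1"
      and r1: "\<And>r \<alpha> \<beta>. r1 \<le> r \<Longrightarrow> \<alpha> \<in> words n (p + r) \<Longrightarrow> \<beta> \<in> words n (q + r) \<Longrightarrow>
        \<exists>c. adj (Sw \<alpha>) * deg_part p q y * Sw \<beta> = scaleC c 1" by metis
    have "\<exists>c. adj (Sw \<alpha>) * deg_part p q (x + y) * Sw \<beta> = scaleC c 1"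
      if r: "max r0 r1 \<le> r" "\<alpha> \<in> words n (p + r)" "\<beta> \<in> words n (q + r)" for r \<alpha> \<beta>
    proof -
      have "r0 \<le> r" "r1 \<le> r" using r by auto
      obtain c d where "adj (Sw \<alpha>) * deg_part p q x * Sw \<beta> = scaleC c 1" "adj (Sw \<alpha>) * deg_part p q y * Sw \<beta> = scaleC d 1"
        using r0[OF \<open>r0 \<le> r\<close> r(2,3)] r1[OF \<open>r1 \<le> r\<close> r(2,3)] by blast
      then show ?thesis by (intro exI[of _ "c + d"]) (simp add: deg_part_add scaleC_add_left distrib_left distrib_right)
    qed
    then show ?case by blast
  next
    case (scale x c)
    then obtain r0 where r0: "\<And>r \<alpha> \<beta>. r0 \<le> r \<Longrightarrow> \<alpha> \<in> words n (p + r) \<Longrightarrow> \<beta> \<in> words n (q + r) \<Longrightarrow>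
        \<exists>c. adj (Sw \<alpha>) * deg_part p q x * Sw \<beta> = scaleC c 1" by metis
    have "\<exists>d. adj (Sw \<alpha>) * deg_part p q (scaleC c x) * Sw \<beta> = scaleC d 1"
      if r: "r0 \<le> r" "\<alpha> \<in> words n (p + r)" "\<beta> \<in> words n (q + r)" for r \<alpha> \<beta>
    proof -
      obtain d where "adj (Sw \<alpha>) * deg_part p q x * Sw \<beta> = scaleC d 1" using r0 r by metis
      then show ?thesis by (intro exI[of _ "c * d"]) (simp add: deg_part_scaleC mult_scaleC_left mult_scaleC_right scaleC_scaleC)
    qed
    then show ?case by blast
  qed
  obtain y where y: "y \<in> alg" "norm (x - y) < e" using approx_alg assms by blast
  have "norm (adj (Sw \<alpha>) * deg_part p q x * Sw \<beta> - scaleC c 1) < e"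
    if "adj (Sw \<alpha>) * deg_part p q y * Sw \<beta> = scaleC c 1" "\<alpha> \<in> words n (p + r)" "\<beta> \<in> words n (q + r)" for \<alpha> \<beta> c r
  proof -
    have "adj (Sw \<alpha>) * deg_part p q x * Sw \<beta> - scaleC c 1 = adj (Sw \<alpha>) * deg_part p q (x - y) * Sw \<beta>"
      unfolding that(1)[symmetric] by (simp add: deg_part_diff left_diff_distrib right_diff_distrib)
    moreover have "norm (adj (Sw \<alpha>) * deg_part p q (x - y) * Sw \<beta>) \<le> norm (deg_part p q (x - y))"
      using that by (intro norm_compression_le Sw_isometry) (auto simp: words_def)
    ultimately show ?thesis using norm_deg_part_le[of p q "x - y"] y by simp
  qed
  then show ?thesis using exact[OF y(1)] by metis
qed

text \<open>
  A central element \<open>c\<close> is unchanged by compression with an isometry. So it has degree \<open>0\<close> and coincides with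
  its own coefficient \<open>S\<^sub>\<alpha>\<^sup>* c S\<^sub>\<alpha>\<close> at arbitrarily long words, which is nearly a scalar.
\<close>

lemma central_imp_scalar:
  fixes c :: 'a
  assumes central: "\<And>x. c * x = x * c"
  shows "\<exists>c0. c = scaleC c0 1"
proof (rule scalar_if_near_scalars)
  fix e :: real assume "0 < e"
  have "compress 0 0 N c = c" for N
  proof -
    have "compress 0 0 N c = c * (adj ((shift ^^ N) (probe N)) * (shift ^^ N) (probe N))"
      unfolding compress_def using central by (simp add: mult.assoc)
    then show ?thesis by (simp add: shifted_probes)
  qed
  then have deg_part: "deg_part 0 0 c = c" by (intro deg_partI) simp
  obtain r0 where r0: "\<And>\<alpha> \<beta>. \<alpha> \<in> words n (0 + r0) \<Longrightarrow> \<beta> \<in> words n (0 + r0) \<Longrightarrow>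
      \<exists>d. norm (adj (Sw \<alpha>) * deg_part 0 0 c * Sw \<beta> - scaleC d 1) < e"
    using deg_part_asymptotically_scalar[OF \<open>0 < e\<close>, of 0 0 c] by blast
  define \<alpha> where "\<alpha> = replicate r0 (1::nat)"
  have \<alpha>: "set \<alpha> \<subseteq> {1..n}" "\<alpha> \<in> words n r0" using letters_1_2 by (auto simp: \<alpha>_def words_def)
  have "adj (Sw \<alpha>) * c * Sw \<alpha> = c * (adj (Sw \<alpha>) * Sw \<alpha>)" using central by (metis mult.assoc)
  then have "adj (Sw \<alpha>) * c * Sw \<alpha> = c" using \<alpha> by (simp add: Sw_isometry)
  then show "\<exists>d. norm (c - scaleC d 1) < e" using r0[of \<alpha> \<alpha>] \<alpha> deg_part by simp
qed

end

context cuntz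
begin

section \<open>Elements that permute words\<close>

text \<open>
  Multiplication by \<open>V\<close> sends long words to words, as \<open>u\<^sup>* S\<^sub>i\<close> does for a permutation unitary \<open>u\<close>. The lower
  bound on the length is the level below which \<open>V\<close> mixes words.
\<close>

definition maps_words :: "nat \<Rightarrow> nat \<Rightarrow> 'a \<Rightarrow> bool" where
  "maps_words m d V \<longleftrightarrow> (\<forall>\<alpha>. set \<alpha> \<subseteq> {1..n} \<longrightarrow> m \<le> length \<alpha> \<longrightarrow>
     (\<exists>\<beta>. V * Sw \<alpha> = Sw \<beta> \<and> set \<beta> \<subseteq> {1..n} \<and> length \<beta> = d + length \<alpha>))"

lemma maps_wordsE:
  assumes "maps_words m d V" "\<alpha> \<in> words n p" "m \<le> p"
  obtains \<beta> where "V * Sw \<alpha> = Sw \<beta>" "\<beta> \<in> words n (d + p)"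
proof -
  have "set \<alpha> \<subseteq> {1..n}" "length \<alpha> = p" using assms by (auto simp: words_def)
  then obtain \<beta> where "V * Sw \<alpha> = Sw \<beta> \<and> set \<beta> \<subseteq> {1..n} \<and> length \<beta> = d + length \<alpha>"
    using assms unfolding maps_words_def by blast
  then show thesis using that[of \<beta>] \<open>length \<alpha> = p\<close> by (simp add: words_def)
qed

lemma maps_words_imp_raises:
  assumes "maps_words m d V"
  shows "raises d V"
proof -
  have "V * (shift ^^ M) x = (shift ^^ (M + d)) x * V" if M: "m \<le> M" for M x
  proof (rule eq_if_eq_on_Sw[of M])
    fix \<alpha> assume \<alpha>: "\<alpha> \<in> words n M"
    then obtain \<beta> where \<beta>: "V * Sw \<alpha> = Sw \<beta>" "\<beta> \<in> words n (d + M)"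
      using maps_wordsE[OF assms _ M] by blast
    have "(shift ^^ M) x * Sw \<alpha> = Sw \<alpha> * x"
      using shifts_mult_Sw[of \<alpha> 0 x] \<alpha> by (simp add: words_def)
    moreover have "(shift ^^ (M + d)) x * Sw \<beta> = Sw \<beta> * x"
      using shifts_mult_Sw[of \<beta> 0 x] \<beta> by (simp add: words_def add.commute)
    ultimately show "V * (shift ^^ M) x * Sw \<alpha> = (shift ^^ (M + d)) x * V * Sw \<alpha>"
      using \<beta>(1) by (simp add: mult.assoc) (simp add: mult.assoc[symmetric])
  qed
  then show ?thesis unfolding raises_def by blast
qed

lemma maps_words_S_word:
  assumes V: "\<And>i. i \<in> {1..n} \<Longrightarrow> maps_words m 1 (V i)" and "set \<mu> \<subseteq> {1..n}"
  shows "maps_words m (length \<mu>) (S_word V \<mu>)"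
  using assms(2)
proof (induction \<mu>)
  case Nil
  show ?case by (auto simp: maps_words_def S_word_def)
next
  case (Cons i \<mu>)
  show ?case unfolding maps_words_def
  proof (intro allI impI)
    fix \<alpha> assume \<alpha>: "set \<alpha> \<subseteq> {1..n}" "m \<le> length \<alpha>"
    then obtain \<beta> where \<beta>: "S_word V \<mu> * Sw \<alpha> = Sw \<beta>" "\<beta> \<in> words n (length \<mu> + length \<alpha>)"
      using maps_wordsE[OF Cons.IH, of \<alpha> "length \<alpha>"] Cons.prems by (auto simp: words_def)
    then obtain \<gamma> where \<gamma>: "V i * Sw \<beta> = Sw \<gamma>" "\<gamma> \<in> words n (1 + (length \<mu> + length \<alpha>))"
      using maps_wordsE[OF V[of i] \<beta>(2)] \<alpha> Cons.prems by auto
    have "S_word V (i # \<mu>) * Sw \<alpha> = V i * (S_word V \<mu> * Sw \<alpha>)" by (simp add: S_word_def mult.assoc)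
    then have "S_word V (i # \<mu>) * Sw \<alpha> = Sw \<gamma>" using \<beta> \<gamma> by simp
    then show "\<exists>\<gamma>. S_word V (i # \<mu>) * Sw \<alpha> = Sw \<gamma> \<and> set \<gamma> \<subseteq> {1..n} \<and>
        length \<gamma> = length (i # \<mu>) + length \<alpha>"
      using \<gamma> by (intro exI[of _ \<gamma>]) (simp add: words_def)
  qed
qed

lemma adj_perm_unitary_mult_Sw:
  assumes u: "perm_unitary n k S u \<sigma>" and \<beta>: "\<beta> \<in> words n k"
  shows "adj u * Sw \<beta> = Sw (inv_into UNIV \<sigma> \<beta>)" and "inv_into UNIV \<sigma> \<beta> \<in> words n k"
proof -
  have \<sigma>: "\<sigma> permutes words n k" and u: "u = (\<Sum>\<alpha>\<in>words n k. Sw (\<sigma> \<alpha>) * adj (Sw \<alpha>))"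
    using u by (auto simp: perm_unitary_def)
  show inv: "inv_into UNIV \<sigma> \<beta> \<in> words n k" using permutes_in_image[OF permutes_inv[OF \<sigma>]] \<beta> by simp
  have "adj u * Sw \<beta> = (\<Sum>\<alpha>\<in>words n k. Sw \<alpha> * (adj (Sw (\<sigma> \<alpha>)) * Sw \<beta>))"
    by (simp add: u adj_sum adj_mult adj_adj sum_distrib_right mult.assoc)
  also have "\<dots> = (\<Sum>\<alpha>\<in>words n k. if \<alpha> = inv_into UNIV \<sigma> \<beta> then Sw \<alpha> else 0)"
  proof (rule sum.cong)
    fix \<alpha> assume \<alpha>: "\<alpha> \<in> words n k"
    have "\<sigma> \<alpha> \<in> words n k" using permutes_in_image[OF \<sigma>] \<alpha> by simp
    then have "adj (Sw (\<sigma> \<alpha>)) * Sw \<beta> = (if \<sigma> \<alpha> = \<beta> then 1 else 0)"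
      using \<beta> by (intro adj_Sw_mult_Sw) (auto simp: words_def)
    moreover have "\<sigma> \<alpha> = \<beta> \<longleftrightarrow> \<alpha> = inv_into UNIV \<sigma> \<beta>" using permutes_inv_eq[OF \<sigma>] by metis
    ultimately show "Sw \<alpha> * (adj (Sw (\<sigma> \<alpha>)) * Sw \<beta>) = (if \<alpha> = inv_into UNIV \<sigma> \<beta> then Sw \<alpha> else 0)" by simp
  qed simp
  also have "\<dots> = Sw (inv_into UNIV \<sigma> \<beta>)" using inv by simp
  finally show "adj u * Sw \<beta> = Sw (inv_into UNIV \<sigma> \<beta>)" .
qed

text \<open>
  Prefixing the letter \<open>i\<close> to a word of length at least \<open>k - 1\<close> gives a word of length at least \<open>k\<close>, whose first
  \<open>k\<close> letters \<open>u\<^sup>*\<close> permutes.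
\<close>

lemma maps_words_lambda:
  assumes u: "perm_unitary n k S u \<sigma>" and k: "1 \<le> k" and i: "i \<in> {1..n}"
  shows "maps_words (k - 1) 1 (adj u * S i)"
  unfolding maps_words_def
proof (intro allI impI)
  fix \<alpha> assume \<alpha>: "set \<alpha> \<subseteq> {1..n}" "k - 1 \<le> length \<alpha>"
  define \<beta> \<gamma> where "\<beta> = take k (i # \<alpha>)" and "\<gamma> = drop k (i # \<alpha>)"
  have sub: "set (i # \<alpha>) \<subseteq> {1..n}" using \<alpha> i by auto
  have \<beta>: "\<beta> \<in> words n k"
    using sub set_take_subset[of k "i # \<alpha>"] \<alpha> k by (auto simp: \<beta>_def words_def)
  have \<gamma>: "set \<gamma> \<subseteq> {1..n}" "k + length \<gamma> = 1 + length \<alpha>"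
    using sub set_drop_subset[of k "i # \<alpha>"] \<alpha> k by (auto simp: \<gamma>_def)
  have "i # \<alpha> = \<beta> @ \<gamma>" by (simp add: \<beta>_def \<gamma>_def)
  then have "S i * Sw \<alpha> = Sw \<beta> * Sw \<gamma>" by (metis Sw_Cons Sw_append)
  then have "adj u * S i * Sw \<alpha> = (adj u * Sw \<beta>) * Sw \<gamma>" by (simp add: mult.assoc)
  also have "\<dots> = Sw (inv_into UNIV \<sigma> \<beta> @ \<gamma>)" using adj_perm_unitary_mult_Sw[OF u \<beta>] by (simp add: Sw_append)
  finally show "\<exists>\<beta>. adj u * S i * Sw \<alpha> = Sw \<beta> \<and> set \<beta> \<subseteq> {1..n} \<and> length \<beta> = 1 + length \<alpha>"
    using adj_perm_unitary_mult_Sw(2)[OF u \<beta>] \<gamma>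
    by (intro exI[of _ "inv_into UNIV \<sigma> \<beta> @ \<gamma>"]) (auto simp: words_def)
qed

lemma lambda_f_map:
  assumes u: "perm_unitary n k S u \<sigma>" and k: "1 \<le> k" and i: "i \<in> {1..n}" and \<alpha>: "\<alpha> \<in> words n (k - 1)"
  obtains m where "m \<in> {1..n}" "f_map n k \<sigma> i \<alpha> \<in> words n (k - 1)"
    "adj u * S i * Sw \<alpha> = Sw (f_map n k \<sigma> i \<alpha> @ [m])"
proof -
  have \<sigma>: "\<sigma> permutes words n k" using u by (simp add: perm_unitary_def)
  obtain m where m: "f_map n k \<sigma> i \<alpha> \<in> words n (k - 1)" "m \<in> {1..n}" "i # \<alpha> = \<sigma> (f_map n k \<sigma> i \<alpha> @ [m])"
    using theI'[OF f_map_ex1[OF k \<sigma> i \<alpha>]] unfolding f_map_def[symmetric] by blast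
  have "i # \<alpha> \<in> words n k" using i \<alpha> k by (auto simp: words_def)
  then have "adj u * Sw (i # \<alpha>) = Sw (inv_into UNIV \<sigma> (i # \<alpha>))" by (rule adj_perm_unitary_mult_Sw[OF u])
  also have "inv_into UNIV \<sigma> (i # \<alpha>) = f_map n k \<sigma> i \<alpha> @ [m]"
    unfolding m(3) by (rule permutes_inverses(2)[OF \<sigma>])
  finally show thesis using that[OF m(2,1)] by (simp add: mult.assoc)
qed

end

section \<open>Inner conjugate endomorphisms\<close>

text \<open>
  What the argument uses about \<open>\<phi> = \<lambda>\<^sub>u\<close> and \<open>\<psi> = \<lambda>\<^sub>w\<close>, with \<open>m = k - 1\<close>.
\<close>

locale inner_conjugate = cuntz +
  fixes \<phi> \<psi> :: "'a \<Rightarrow> 'a" and z :: 'a and m :: nat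
  assumes \<phi>: "unital_star_endomorphism \<phi>" and bij_\<phi>: "bij \<phi>"
    and \<phi>_maps_words: "\<And>i. i \<in> {1..n} \<Longrightarrow> maps_words m 1 (\<phi> (S i))"
    and \<psi>_maps_words: "\<And>i. i \<in> {1..n} \<Longrightarrow> maps_words m 1 (\<psi> (S i))"
    and z: "unitary z" and \<psi>_eq: "\<And>x. \<psi> x = z * \<phi> x * adj z"
begin

lemma zz: "adj z * z = 1" "z * adj z = 1"
  using z by (auto simp: unitary_def)

lemma zz_left: "adj z * (z * x) = x" "z * (adj z * x) = x"
  using zz by (metis mult.assoc mult_1_left)+

lemma \<phi>_hom: "\<phi> (x + y) = \<phi> x + \<phi> y" "\<phi> (x * y) = \<phi> x * \<phi> y" "\<phi> (scaleC c x) = scaleC c (\<phi> x)"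
    "\<phi> (adj x) = adj (\<phi> x)" "\<phi> 1 = 1"
  using \<phi> by (auto simp: unital_star_endomorphism_def)

lemma bounded_linear_\<phi>: "bounded_linear \<phi>"
  by (rule unital_star_endomorphism_bounded_linear[OF \<phi>])

lemmas continuous_on_\<phi> [continuous_intros] = bounded_linear.continuous_on[OF bounded_linear_\<phi>]

lemma \<phi>_zero [simp]: "\<phi> 0 = 0"
  using \<phi>_hom(3)[of 0 0] by simp

lemma \<phi>_diff: "\<phi> (x - y) = \<phi> x - \<phi> y"
  using \<phi>_hom(1)[of "x - y" y] by simp

lemma \<phi>_sum: "\<phi> (\<Sum>i\<in>I. f i) = (\<Sum>i\<in>I. \<phi> (f i))"
  by (induction I rule: infinite_finite_induct) (auto simp: \<phi>_hom)

lemma \<phi>_Sw: "\<phi> (Sw \<mu>) = S_word (\<lambda>i. \<phi> (S i)) \<mu>"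
  by (induction \<mu>) (auto simp: S_word_def \<phi>_hom)

lemma \<psi>_hom: "\<psi> (x * y) = \<psi> x * \<psi> y" "\<psi> (adj x) = adj (\<psi> x)" "\<psi> 1 = 1"
  by (simp_all add: \<psi>_eq \<phi>_hom adj_mult adj_adj mult.assoc zz zz_left)

lemma \<psi>_Sw: "\<psi> (Sw \<mu>) = S_word (\<lambda>i. \<psi> (S i)) \<mu>"
  by (induction \<mu>) (auto simp: S_word_def \<psi>_hom)

lemma z_intertwines: "z * \<phi> x = \<psi> x * z"
  by (simp add: \<psi>_eq mult.assoc zz)

lemma \<phi>_Sw_maps_words: "set \<mu> \<subseteq> {1..n} \<Longrightarrow> maps_words m (length \<mu>) (\<phi> (Sw \<mu>))"
  unfolding \<phi>_Sw by (intro maps_words_S_word \<phi>_maps_words)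

lemma \<psi>_Sw_maps_words: "set \<mu> \<subseteq> {1..n} \<Longrightarrow> maps_words m (length \<mu>) (\<psi> (Sw \<mu>))"
  unfolding \<psi>_Sw by (intro maps_words_S_word \<psi>_maps_words)

text \<open>
  \<open>\<phi>\<close> preserves degrees because the images of the generators again have degree one.
\<close>

lemma deg_part_\<phi>: "deg_part 0 0 (\<phi> x) = \<phi> (deg_part 0 0 x)"
proof (induction x rule: dense_induct)
  case closed
  show ?case by (intro closed_Collect_eq continuous_intros)
next
  case (monomial \<alpha> \<beta>)
  define a b A B where "a = length \<alpha>" and "b = length \<beta>" and "A = \<phi> (Sw \<alpha>)" and "B = \<phi> (Sw \<beta>)"
  have A: "raises a A" and B: "raises b B"
    using monomial by (auto simp: a_def b_def A_def B_def intro: maps_words_imp_raises \<phi>_Sw_maps_words)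
  have "deg_part 0 0 (A * (1 * adj B)) = deg_part ((a + b) + 0) ((a + b) + 0) (A * (1 * adj B))"
    by (rule deg_part_diagonal_invariant[symmetric])
  also have "\<dots> = deg_part (a + b) (b + a) (A * (1 * adj B))" by (simp add: add.commute)
  also have "\<dots> = A * (deg_part b a 1 * adj B)"
    by (simp only: deg_part_raise_left[OF A] deg_part_raise_adj_right[OF B])
  finally show ?case
    using monomial by (simp add: \<phi>_hom deg_part_monomial deg_part_one a_def b_def A_def B_def)
qed (auto simp: \<phi>_hom deg_part_add deg_part_scaleC)

lemma sum_\<phi>_ranges: "(\<Sum>\<mu>\<in>words n r. \<phi> (Sw \<mu>) * adj (\<phi> (Sw \<mu>))) = 1"
proof -
  have "\<phi> (\<Sum>\<mu>\<in>words n r. Sw \<mu> * adj (Sw \<mu>)) = 1" by (simp only: sum_word_ranges \<phi>_hom)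
  then show ?thesis by (simp add: \<phi>_sum \<phi>_hom)
qed

lemma sum_\<psi>_ranges: "(\<Sum>i=1..n. \<psi> (S i) * adj (\<psi> (S i))) = 1"
proof -
  have "(\<Sum>i=1..n. \<psi> (S i) * adj (\<psi> (S i))) = z * \<phi> (\<Sum>i=1..n. S i * adj (S i)) * adj z"
    by (simp add: \<phi>_sum \<phi>_hom sum_distrib_left sum_distrib_right \<psi>_eq adj_mult adj_adj mult.assoc zz_left)
  then show ?thesis by (simp only: sum_ranges \<phi>_hom mult_1_right zz)
qed

lemma sum_\<phi>_gen_ranges: "(\<Sum>i=1..n. \<phi> (S i) * adj (\<phi> (S i))) = 1"
proof -
  have "\<phi> (\<Sum>i=1..n. S i * adj (S i)) = 1" by (simp only: sum_ranges \<phi>_hom)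
  then show ?thesis by (simp add: \<phi>_sum \<phi>_hom)
qed

text \<open>
  The same identity holds for \<open>z\<close> itself by the Cuntz relations for the \<open>\<phi> (S i)\<close>, and both outer factors are
  homogeneous of degree one, so it passes to the homogeneous parts.
\<close>

lemma deg_part_sandwich:
  assumes i: "i \<in> {1..n}" and j: "j \<in> {1..n}"
  shows "adj (\<psi> (S j)) * deg_part p q z * \<phi> (S i) = (if i = j then deg_part p q z else 0)"
proof -
  have r: "raises 1 (\<phi> (S i))" "raises 1 (\<psi> (S j))"
    using \<phi>_maps_words[OF i] \<psi>_maps_words[OF j] maps_words_imp_raises by blast+
  have "adj (\<psi> (S j)) * deg_part p q z * \<phi> (S i) = adj (\<psi> (S j)) * (deg_part (1 + p) (1 + q) z * \<phi> (S i))"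
    by (simp add: deg_part_diagonal_invariant mult.assoc)
  also have "\<dots> = deg_part p q (adj (\<psi> (S j)) * (z * \<phi> (S i)))"
    by (simp only: deg_part_raise_adj_left[OF r(2)] deg_part_raise_right[OF r(1)])
  also have "adj (\<psi> (S j)) * (z * \<phi> (S i)) = z * \<phi> (adj (S j) * S i)"
    by (simp add: \<psi>_eq \<phi>_hom adj_mult adj_adj mult.assoc zz_left)
  also have "\<dots> = (if i = j then z else 0)" using i j by (simp add: adj_S_mult_S \<phi>_hom)
  finally show ?thesis by simp
qed

lemma deg_part_intertwines:
  assumes i: "i \<in> {1..n}"
  shows "deg_part p q z * \<phi> (S i) = \<psi> (S i) * deg_part p q z"
    and "deg_part p q z * adj (\<phi> (S i)) = adj (\<psi> (S i)) * deg_part p q z"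
proof -
  let ?y = "deg_part p q z"
  have "?y * \<phi> (S i) = (\<Sum>j=1..n. \<psi> (S j) * adj (\<psi> (S j))) * (?y * \<phi> (S i))"
    by (simp only: sum_\<psi>_ranges mult_1_left)
  also have "\<dots> = (\<Sum>j=1..n. \<psi> (S j) * (adj (\<psi> (S j)) * ?y * \<phi> (S i)))"
    by (simp add: sum_distrib_right mult.assoc)
  also have "\<dots> = (\<Sum>j=1..n. if j = i then \<psi> (S i) * ?y else 0)"
    by (intro sum.cong) (auto simp: deg_part_sandwich[OF _ i] deg_part_sandwich[OF i])
  finally show "?y * \<phi> (S i) = \<psi> (S i) * ?y" using i by simp
  have "adj (\<psi> (S i)) * ?y = (adj (\<psi> (S i)) * ?y) * (\<Sum>j=1..n. \<phi> (S j) * adj (\<phi> (S j)))"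
    by (simp only: sum_\<phi>_gen_ranges mult_1_right)
  also have "\<dots> = (\<Sum>j=1..n. (adj (\<psi> (S i)) * ?y * \<phi> (S j)) * adj (\<phi> (S j)))"
    by (simp add: sum_distrib_left mult.assoc)
  also have "\<dots> = (\<Sum>j=1..n. if j = i then ?y * adj (\<phi> (S i)) else 0)"
    by (intro sum.cong) (auto simp: deg_part_sandwich[OF _ i] deg_part_sandwich[OF i])
  finally show "?y * adj (\<phi> (S i)) = adj (\<psi> (S i)) * ?y" using i by simp
qed

text \<open>
  Both \<open>z\<close> and its part intertwine \<open>\<phi>\<close> and \<open>\<psi>\<close>. So \<open>z\<^sup>*\<close> times the part commutes with the range of \<open>\<phi>\<close>, which is
  the whole algebra, and is a scalar.
\<close>

lemma deg_part_multiple: "\<exists>c. deg_part p q z = scaleC c z"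
proof -
  define c where "c = adj z * deg_part p q z"
  have gen: "c * \<phi> (S i) = \<phi> (S i) * c" "c * adj (\<phi> (S i)) = adj (\<phi> (S i)) * c" if i: "i \<in> {1..n}" for i
  proof -
    have "c * \<phi> (S i) = adj z * (\<psi> (S i) * deg_part p q z)"
      by (simp only: c_def mult.assoc deg_part_intertwines(1)[OF i])
    then show "c * \<phi> (S i) = \<phi> (S i) * c" by (simp add: \<psi>_eq c_def mult.assoc zz_left)
    have "c * adj (\<phi> (S i)) = adj z * (adj (\<psi> (S i)) * deg_part p q z)"
      by (simp only: c_def mult.assoc deg_part_intertwines(2)[OF i])
    then show "c * adj (\<phi> (S i)) = adj (\<phi> (S i)) * c"
      by (simp add: \<psi>_eq c_def adj_mult adj_adj mult.assoc zz_left)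
  qed
  have word: "c * \<phi> (Sw \<alpha>) = \<phi> (Sw \<alpha>) * c \<and> c * adj (\<phi> (Sw \<alpha>)) = adj (\<phi> (Sw \<alpha>)) * c"
    if "set \<alpha> \<subseteq> {1..n}" for \<alpha>
    using that
  proof (induction \<alpha>)
    case (Cons i \<alpha>)
    have i: "i \<in> {1..n}" and IH: "c * \<phi> (Sw \<alpha>) = \<phi> (Sw \<alpha>) * c" "c * adj (\<phi> (Sw \<alpha>)) = adj (\<phi> (Sw \<alpha>)) * c"
      using Cons by auto
    have "c * \<phi> (S i) * \<phi> (Sw \<alpha>) = \<phi> (S i) * (c * \<phi> (Sw \<alpha>))" by (simp only: gen(1)[OF i] mult.assoc)
    moreover have "c * adj (\<phi> (Sw \<alpha>)) * adj (\<phi> (S i)) = adj (\<phi> (Sw \<alpha>)) * (c * adj (\<phi> (S i)))"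
      by (simp only: IH(2) mult.assoc)
    ultimately show ?case by (simp add: \<phi>_hom adj_mult IH(1) gen(2)[OF i] mult.assoc)
  qed (simp_all add: \<phi>_hom adj_one)
  have comm: "c * \<phi> x = \<phi> x * c" for x
  proof (induction x rule: dense_induct)
    case closed
    show ?case by (intro closed_Collect_eq continuous_intros)
  next
    case (monomial \<alpha> \<beta>)
    have "c * \<phi> (Sw \<alpha>) * adj (\<phi> (Sw \<beta>)) = \<phi> (Sw \<alpha>) * (c * adj (\<phi> (Sw \<beta>)))"
      by (simp only: word[OF monomial(1), THEN conjunct1] mult.assoc)
    then show ?case by (simp add: \<phi>_hom word[OF monomial(2), THEN conjunct2] mult.assoc)
  qed (auto simp: \<phi>_hom distrib_left distrib_right mult_scaleC_left mult_scaleC_right)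
  have "c * x = x * c" for x using comm[of "inv_into UNIV \<phi> x"] bij_\<phi> by (simp add: bij_is_surj surj_f_inv_f)
  then obtain c0 where "c = scaleC c0 1" using central_imp_scalar by blast
  then have "z * c = scaleC c0 z" by (simp add: mult_scaleC_right)
  moreover have "z * c = deg_part p q z" by (simp add: c_def zz_left)
  ultimately show ?thesis by metis
qed

text \<open>
  By \<open>deg_part_sandwich\<close> the coefficient at \<open>(\<alpha>, \<beta>)\<close> equals the one at the pair of words to which \<open>\<psi> (S 1)\<close>
  and \<open>\<phi> (S 1)\<close> map \<open>\<alpha>\<close> and \<open>\<beta>\<close>. Repeating this moves to arbitrarily long words, where coefficients are nearly
  scalar.
\<close>

lemma deg_part_coefficient:
  assumes pq: "m \<le> p" "m \<le> q" and \<alpha>: "\<alpha> \<in> words n p" and \<beta>: "\<beta> \<in> words n q"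
  shows "\<exists>c. adj (Sw \<alpha>) * deg_part p q z * Sw \<beta> = scaleC c 1"
proof (rule scalar_if_near_scalars)
  let ?y = "deg_part p q z"
  have push: "\<exists>\<alpha>'\<in>words n (p + r). \<exists>\<beta>'\<in>words n (q + r). adj (Sw \<alpha>) * ?y * Sw \<beta> = adj (Sw \<alpha>') * ?y * Sw \<beta>'" for r
  proof (induction r)
    case 0
    show ?case using \<alpha> \<beta> by auto
  next
    case (Suc r)
    then obtain \<alpha>' \<beta>' where IH: "\<alpha>' \<in> words n (p + r)" "\<beta>' \<in> words n (q + r)"
      "adj (Sw \<alpha>) * ?y * Sw \<beta> = adj (Sw \<alpha>') * ?y * Sw \<beta>'" by blast
    obtain \<alpha>'' where \<alpha>'': "\<psi> (S 1) * Sw \<alpha>' = Sw \<alpha>''" "\<alpha>'' \<in> words n (1 + (p + r))"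
      using maps_wordsE[OF \<psi>_maps_words[OF letters_1_2(1)] IH(1)] pq by auto
    obtain \<beta>'' where \<beta>'': "\<phi> (S 1) * Sw \<beta>' = Sw \<beta>''" "\<beta>'' \<in> words n (1 + (q + r))"
      using maps_wordsE[OF \<phi>_maps_words[OF letters_1_2(1)] IH(2)] pq by auto
    have "adj (Sw \<alpha>'') * ?y * Sw \<beta>'' = adj (Sw \<alpha>') * (adj (\<psi> (S 1)) * ?y * \<phi> (S 1)) * Sw \<beta>'"
      unfolding \<alpha>''(1)[symmetric] \<beta>''(1)[symmetric] by (simp only: adj_mult mult.assoc)
    then have "adj (Sw \<alpha>'') * ?y * Sw \<beta>'' = adj (Sw \<alpha>') * ?y * Sw \<beta>'"
      using deg_part_sandwich[OF letters_1_2(1) letters_1_2(1)] by simp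
    then show ?case using IH(3) \<alpha>''(2) \<beta>''(2) by (simp add: plus_1_eq_Suc) metis
  qed
  fix e :: real assume "0 < e"
  then obtain r where r: "\<And>\<alpha> \<beta>. \<alpha> \<in> words n (p + r) \<Longrightarrow> \<beta> \<in> words n (q + r) \<Longrightarrow>
      \<exists>c. norm (adj (Sw \<alpha>) * ?y * Sw \<beta> - scaleC c 1) < e"
    using deg_part_asymptotically_scalar[of e p q z] by blast
  obtain \<alpha>' \<beta>' where "\<alpha>' \<in> words n (p + r)" "\<beta>' \<in> words n (q + r)"
      "adj (Sw \<alpha>) * ?y * Sw \<beta> = adj (Sw \<alpha>') * ?y * Sw \<beta>'"
    using push by blast
  with r show "\<exists>c. norm (adj (Sw \<alpha>) * ?y * Sw \<beta> - scaleC c 1) < e" by metis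
qed

text \<open>
  Rows and columns of the matrix \<open>Z\<close> are unit vectors, so the sum of all \<open>\<bar>Z \<alpha> \<beta>\<bar>\<^sup>2\<close> is both the number of
  rows and the number of columns.
\<close>

lemma equal_lengths_if_scalar_coefficients:
  assumes Z: "\<And>\<alpha> \<beta>. \<alpha> \<in> words n p \<Longrightarrow> \<beta> \<in> words n q \<Longrightarrow> adj (Sw \<alpha>) * z * Sw \<beta> = scaleC (Z \<alpha> \<beta>) 1"
  shows "p = q"
proof -
  have adj_Z: "adj (Sw \<beta>) * adj z * Sw \<alpha> = scaleC (cnj (Z \<alpha> \<beta>)) 1" if "\<alpha> \<in> words n p" "\<beta> \<in> words n q" for \<alpha> \<beta>
  proof -
    have "adj (adj (Sw \<alpha>) * z * Sw \<beta>) = scaleC (cnj (Z \<alpha> \<beta>)) 1"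
      by (simp add: Z[OF that] adj_scaleC adj_one)
    then show ?thesis by (simp add: adj_mult adj_adj mult.assoc)
  qed
  have iso: "adj (Sw \<gamma>) * Sw \<gamma> = 1" if "\<gamma> \<in> words n r" for \<gamma> r
    using that by (simp add: Sw_isometry words_def)
  have col: "(\<Sum>\<alpha>\<in>words n p. Z \<alpha> \<beta> * cnj (Z \<alpha> \<beta>)) = 1" if \<beta>: "\<beta> \<in> words n q" for \<beta>
  proof -
    have "scaleC (\<Sum>\<alpha>\<in>words n p. Z \<alpha> \<beta> * cnj (Z \<alpha> \<beta>)) 1
        = (\<Sum>\<alpha>\<in>words n p. (adj (Sw \<beta>) * adj z * Sw \<alpha>) * (adj (Sw \<alpha>) * z * Sw \<beta>))"
      unfolding scaleC_sum_left
      by (intro sum.cong) (simp_all add: Z adj_Z \<beta> mult_scaleC_left scaleC_scaleC mult.commute)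
    also have "\<dots> = adj (Sw \<beta>) * adj z * (\<Sum>\<alpha>\<in>words n p. Sw \<alpha> * adj (Sw \<alpha>)) * (z * Sw \<beta>)"
      by (simp add: sum_distrib_left sum_distrib_right mult.assoc)
    also have "\<dots> = 1" using iso[OF \<beta>] by (simp add: sum_word_ranges mult.assoc zz_left)
    finally show ?thesis by (metis scaleC_eq_iff scaleC_one zero_neq_one)
  qed
  have row: "(\<Sum>\<beta>\<in>words n q. Z \<alpha> \<beta> * cnj (Z \<alpha> \<beta>)) = 1" if \<alpha>: "\<alpha> \<in> words n p" for \<alpha>
  proof -
    have "scaleC (\<Sum>\<beta>\<in>words n q. Z \<alpha> \<beta> * cnj (Z \<alpha> \<beta>)) 1
        = (\<Sum>\<beta>\<in>words n q. (adj (Sw \<alpha>) * z * Sw \<beta>) * (adj (Sw \<beta>) * adj z * Sw \<alpha>))"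
      unfolding scaleC_sum_left
      by (intro sum.cong) (simp_all add: Z adj_Z \<alpha> mult_scaleC_left scaleC_scaleC mult.commute)
    also have "\<dots> = adj (Sw \<alpha>) * z * (\<Sum>\<beta>\<in>words n q. Sw \<beta> * adj (Sw \<beta>)) * (adj z * Sw \<alpha>)"
      by (simp add: sum_distrib_left sum_distrib_right mult.assoc)
    also have "\<dots> = 1" using iso[OF \<alpha>] by (simp add: sum_word_ranges mult.assoc zz_left)
    finally show ?thesis by (metis scaleC_eq_iff scaleC_one zero_neq_one)
  qed
  have "(of_nat (n ^ q) :: complex) = (\<Sum>\<beta>\<in>words n q. \<Sum>\<alpha>\<in>words n p. Z \<alpha> \<beta> * cnj (Z \<alpha> \<beta>))"
    by (simp add: col card_words)
  also have "\<dots> = (\<Sum>\<alpha>\<in>words n p. \<Sum>\<beta>\<in>words n q. Z \<alpha> \<beta> * cnj (Z \<alpha> \<beta>))" by (rule sum.swap)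
  also have "\<dots> = of_nat (n ^ p)" by (simp add: row card_words)
  finally have "n ^ q = n ^ p" by (simp only: of_nat_eq_iff)
  then show ?thesis using n_ge_2 power_inject_exp[of n q p] by simp
qed

lemma z_scalar_coefficients:
  assumes "\<alpha> \<in> words n m" "\<beta> \<in> words n m"
  shows "\<exists>c. adj (Sw \<alpha>) * z * Sw \<beta> = scaleC c 1"
proof -
  obtain p q where pq: "min p q = m" "deg_part p q z \<noteq> 0" using deg_part_nonzero[OF z] by blast
  obtain c where c: "deg_part p q z = scaleC c z" using deg_part_multiple by blast
  with pq have "c \<noteq> 0" by auto
  then have z_eq: "z = scaleC (1 / c) (deg_part p q z)" by (simp add: c scaleC_scaleC)
  have coeff: "\<exists>d. adj (Sw \<alpha>) * z * Sw \<beta> = scaleC d 1" if ab: "\<alpha> \<in> words n p" "\<beta> \<in> words n q" for \<alpha> \<beta>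
  proof -
    have "m \<le> p" "m \<le> q" using pq by auto
    then obtain d where "adj (Sw \<alpha>) * deg_part p q z * Sw \<beta> = scaleC d 1"
      using deg_part_coefficient ab by blast
    then have "adj (Sw \<alpha>) * z * Sw \<beta> = scaleC (1 / c * d) 1"
      by (subst z_eq) (simp add: mult_scaleC_left mult_scaleC_right scaleC_scaleC)
    then show ?thesis by blast
  qed
  then obtain Z where "\<And>\<alpha> \<beta>. \<alpha> \<in> words n p \<Longrightarrow> \<beta> \<in> words n q \<Longrightarrow> adj (Sw \<alpha>) * z * Sw \<beta> = scaleC (Z \<alpha> \<beta>) 1"
    by metis
  then have "p = q" by (rule equal_lengths_if_scalar_coefficients)
  then show ?thesis using coeff assms pq by simp
qed

text \<open>
  Over all \<open>\<alpha>\<close> this says: long enough compositions of the maps on words attached to \<open>\<phi>\<close> are constant; this is where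
  surjectivity of \<open>\<phi>\<close> enters. Writing the projection as \<open>\<phi> x\<close>, the element \<open>x\<close> has degree \<open>0\<close> by injectivity, so
  \<open>S\<^sub>\<mu>\<^sup>* x S\<^sub>\<mu>\<close> is close to a scalar for long \<open>\<mu>\<close>, and so is its image under \<open>\<phi>\<close>. That image acts on each word of
  length \<open>m\<close> as \<open>0\<close> or \<open>1\<close>; values closer than \<open>1\<close> to each other must be equal.
\<close>

lemma range_projection_diagonal:
  assumes \<alpha>: "\<alpha> \<in> words n m"
  shows "\<exists>r. \<forall>\<mu>\<in>words n r. \<exists>c. Sw \<alpha> * adj (Sw \<alpha>) * \<phi> (Sw \<mu>) = scaleC c (\<phi> (Sw \<mu>))"
proof -
  define P where "P = Sw \<alpha> * adj (Sw \<alpha>)"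
  have s\<alpha>: "set \<alpha> \<subseteq> {1..n}" "length \<alpha> = m" using \<alpha> by (auto simp: words_def)
  obtain x where x: "\<phi> x = P" using bij_\<phi> by (metis bij_pointE)
  have "\<phi> (deg_part 0 0 x) = \<phi> x"
    using s\<alpha> deg_part_monomial[of \<alpha> \<alpha> 0 0] by (simp add: deg_part_\<phi>[symmetric] x P_def)
  then have x_deg: "deg_part 0 0 x = x" using bij_\<phi> by (metis bij_pointE)
  have "(0::real) < 1 / 2" by simp
  from deg_part_asymptotically_scalar[OF this, of 0 0 x]
  obtain r where "\<forall>\<alpha>\<in>words n (0 + r). \<forall>\<beta>\<in>words n (0 + r).
      \<exists>c. norm (adj (Sw \<alpha>) * deg_part 0 0 x * Sw \<beta> - scaleC c 1) < 1 / 2" by blast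
  then have r: "\<exists>c. norm (adj (Sw \<mu>) * x * Sw \<mu> - scaleC c 1) < 1 / 2" if "\<mu> \<in> words n r" for \<mu>
    using that unfolding x_deg add_0 by blast
  have "\<exists>c. P * \<phi> (Sw \<mu>) = scaleC c (\<phi> (Sw \<mu>))" if \<mu>: "\<mu> \<in> words n r" for \<mu>
  proof -
    define A where "A = \<phi> (Sw \<mu>)"
    have A: "adj A * A = 1"
    proof -
      have "\<phi> (adj (Sw \<mu>) * Sw \<mu>) = 1" using \<mu> by (simp add: Sw_isometry words_def \<phi>_hom)
      then show ?thesis by (simp add: A_def \<phi>_hom)
    qed
    then have adj_A_cancel: "adj A * (A * y) = y" for y by (metis mult.assoc mult_1_left)
    have mw: "maps_words m r A" using \<phi>_Sw_maps_words[of \<mu>] \<mu> by (simp add: A_def words_def)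
    obtain c where c: "norm (adj (Sw \<mu>) * x * Sw \<mu> - scaleC c 1) < 1 / 2" using r[OF \<mu>] by blast
    have "norm (\<phi> (adj (Sw \<mu>) * x * Sw \<mu> - scaleC c 1)) < 1 / 2"
      using unital_star_endomorphism_contractive[OF \<phi>] c by (rule le_less_trans)
    then have near: "norm (adj A * P * A - scaleC c 1) < 1 / 2"
      by (simp add: \<phi>_diff \<phi>_hom x A_def)
    \<comment> \<open>whether \<open>\<alpha>\<close> is a prefix of the word \<open>A S\<^sub>\<delta>\<close>\<close>
    define \<epsilon> :: "nat list \<Rightarrow> complex"
      where "\<epsilon> \<delta> = (if P * (A * Sw \<delta>) = A * Sw \<delta> then 1 else 0)" for \<delta>
    have PA: "P * (A * Sw \<delta>) = scaleC (\<epsilon> \<delta>) (A * Sw \<delta>)" if \<delta>: "\<delta> \<in> words n m" for \<delta>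
    proof -
      obtain \<eta> where \<eta>: "A * Sw \<delta> = Sw \<eta>" "\<eta> \<in> words n (r + m)" using maps_wordsE[OF mw \<delta>] by auto
      have "P * Sw \<eta> = Sw \<alpha> * (adj (Sw \<alpha>) * Sw \<eta>)" by (simp add: P_def mult.assoc)
      also have "\<dots> = Sw \<alpha> * (if take m \<eta> = \<alpha> then Sw (drop m \<eta>) else 0)"
        using adj_Sw_mult_longer[of \<alpha> \<eta>] s\<alpha> \<eta>(2) by (simp add: words_def)
      also have "\<dots> = (if take m \<eta> = \<alpha> then Sw \<eta> else 0)"
        by (metis Sw_append append_take_drop_id mult_zero_right)
      finally have "P * Sw \<eta> = Sw \<eta> \<or> P * Sw \<eta> = 0" by metis
      then show ?thesis by (auto simp: \<epsilon>_def \<eta>(1))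
    qed
    have \<epsilon>_near: "cmod (\<epsilon> \<delta> - c) < 1 / 2" if \<delta>: "\<delta> \<in> words n m" for \<delta>
    proof -
      have "(adj A * P * A - scaleC c 1) * Sw \<delta> = adj A * (P * (A * Sw \<delta>)) - scaleC c (Sw \<delta>)"
        by (simp add: left_diff_distrib mult.assoc mult_scaleC_left)
      also have "\<dots> = scaleC (\<epsilon> \<delta> - c) (Sw \<delta>)"
        by (simp add: PA[OF \<delta>] mult_scaleC_right scaleC_diff_left adj_A_cancel)
      finally have "cmod (\<epsilon> \<delta> - c) * norm (Sw \<delta>) \<le> norm (adj A * P * A - scaleC c 1) * norm (Sw \<delta>)"
        by (metis norm_mult_ineq norm_scaleC)
      moreover have "norm (Sw \<delta>) = 1" using \<delta> by (intro norm_isometry Sw_isometry) (simp add: words_def)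
      ultimately show ?thesis using near by simp
    qed
    have \<epsilon>_const: "\<epsilon> \<delta> = \<epsilon> \<delta>'" if "\<delta> \<in> words n m" "\<delta>' \<in> words n m" for \<delta> \<delta>'
    proof -
      have "cmod ((\<epsilon> \<delta> - c) - (\<epsilon> \<delta>' - c)) < 1"
        using norm_triangle_ineq4[of "\<epsilon> \<delta> - c" "\<epsilon> \<delta>' - c"] \<epsilon>_near[OF that(1)] \<epsilon>_near[OF that(2)] by linarith
      then have "cmod (\<epsilon> \<delta> - \<epsilon> \<delta>') < 1" by simp
      then show ?thesis by (auto simp: \<epsilon>_def split: if_splits)
    qed
    have "P * A = scaleC (\<epsilon> \<alpha>) A"
    proof (rule eq_if_eq_on_Sw[of m])
      fix \<delta> assume \<delta>: "\<delta> \<in> words n m"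
      show "P * A * Sw \<delta> = scaleC (\<epsilon> \<alpha>) A * Sw \<delta>"
        using PA[OF \<delta>] \<epsilon>_const[OF \<delta> \<alpha>] by (simp add: mult.assoc mult_scaleC_left)
    qed
    then show ?thesis unfolding A_def by blast
  qed
  then show ?thesis unfolding P_def by blast
qed

text \<open>
  The range projection of \<open>\<psi> (S\<^sub>\<mu>)\<close> is the sum of the range projections of the words \<open>\<psi> (S\<^sub>\<mu>) S\<^sub>\<delta>\<close> with \<open>\<bar>\<delta>\<bar> = m\<close>.
  These words have length at least \<open>m\<close> and cannot begin with both \<open>\<gamma>\<close> and \<open>\<gamma>'\<close>. By \<open>range_projection_diagonal\<close>,
  conjugating \<open>S\<^sub>\<alpha> S\<^sub>\<alpha>\<^sup>*\<close> by \<open>z\<close> produces a combination of such projections.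
\<close>

lemma off_diagonal_zero:
  assumes \<alpha>: "\<alpha> \<in> words n m" and \<gamma>: "\<gamma> \<in> words n m" "\<gamma>' \<in> words n m" "\<gamma> \<noteq> \<gamma>'"
  shows "adj (Sw \<gamma>) * (z * (Sw \<alpha> * adj (Sw \<alpha>)) * adj z) * Sw \<gamma>' = 0"
proof -
  define P where "P = Sw \<alpha> * adj (Sw \<alpha>)"
  obtain r where "\<forall>\<mu>\<in>words n r. \<exists>c. P * \<phi> (Sw \<mu>) = scaleC c (\<phi> (Sw \<mu>))"
    using range_projection_diagonal[OF \<alpha>] unfolding P_def by blast
  then obtain c where c: "\<And>\<mu>. \<mu> \<in> words n r \<Longrightarrow> P * \<phi> (Sw \<mu>) = scaleC (c \<mu>) (\<phi> (Sw \<mu>))" by metis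
  have "P = P * (\<Sum>\<mu>\<in>words n r. \<phi> (Sw \<mu>) * adj (\<phi> (Sw \<mu>)))" by (simp add: sum_\<phi>_ranges)
  also have "\<dots> = (\<Sum>\<mu>\<in>words n r. (P * \<phi> (Sw \<mu>)) * adj (\<phi> (Sw \<mu>)))"
    by (simp add: sum_distrib_left mult.assoc)
  also have "\<dots> = (\<Sum>\<mu>\<in>words n r. scaleC (c \<mu>) (\<phi> (Sw \<mu>) * adj (\<phi> (Sw \<mu>))))"
    by (intro sum.cong) (simp_all add: c mult_scaleC_left)
  finally have P: "P = (\<Sum>\<mu>\<in>words n r. scaleC (c \<mu>) (\<phi> (Sw \<mu>) * adj (\<phi> (Sw \<mu>))))" .
  have zero: "adj (Sw \<gamma>) * (\<psi> (Sw \<mu>) * adj (\<psi> (Sw \<mu>))) * Sw \<gamma>' = 0" if \<mu>: "\<mu> \<in> words n r" for \<mu>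
  proof -
    define A where "A = \<psi> (Sw \<mu>)"
    have mw: "maps_words m r A" using \<psi>_Sw_maps_words[of \<mu>] \<mu> by (simp add: A_def words_def)
    have "(adj (Sw \<gamma>) * (A * Sw \<delta>)) * (adj (A * Sw \<delta>) * Sw \<gamma>') = 0" if \<delta>: "\<delta> \<in> words n m" for \<delta>
    proof -
      obtain \<eta> where \<eta>: "A * Sw \<delta> = Sw \<eta>" "\<eta> \<in> words n (r + m)" using maps_wordsE[OF mw \<delta>] by auto
      have *: "adj (Sw g) * Sw \<eta> = 0" if "g \<in> words n m" "take m \<eta> \<noteq> g" for g
        using adj_Sw_mult_longer[of g \<eta>] that \<eta>(2) by (auto simp: words_def)
      have "adj (Sw \<gamma>) * Sw \<eta> = 0 \<or> adj (Sw \<gamma>') * Sw \<eta> = 0" using * \<gamma> by metis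
      moreover have "adj (Sw \<eta>) * Sw \<gamma>' = adj (adj (Sw \<gamma>') * Sw \<eta>)" by (simp add: adj_mult adj_adj)
      ultimately show ?thesis unfolding \<eta>(1) by auto
    qed
    then have "(\<Sum>\<delta>\<in>words n m. (adj (Sw \<gamma>) * (A * Sw \<delta>)) * (adj (A * Sw \<delta>) * Sw \<gamma>')) = 0" by simp
    moreover have "(\<Sum>\<delta>\<in>words n m. (adj (Sw \<gamma>) * (A * Sw \<delta>)) * (adj (A * Sw \<delta>) * Sw \<gamma>'))
        = adj (Sw \<gamma>) * A * (\<Sum>\<delta>\<in>words n m. Sw \<delta> * adj (Sw \<delta>)) * (adj A * Sw \<gamma>')"
      by (simp add: sum_distrib_left sum_distrib_right adj_mult mult.assoc)
    ultimately show ?thesis by (simp add: sum_word_ranges mult.assoc A_def)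
  qed
  have "z * P * adj z = (\<Sum>\<mu>\<in>words n r. scaleC (c \<mu>) (\<psi> (Sw \<mu>) * adj (\<psi> (Sw \<mu>))))"
    by (subst P) (simp add: sum_distrib_left sum_distrib_right \<psi>_eq adj_mult adj_adj mult.assoc zz_left
      mult_scaleC_left mult_scaleC_right)
  then have "adj (Sw \<gamma>) * (z * P * adj z) * Sw \<gamma>'
      = (\<Sum>\<mu>\<in>words n r. scaleC (c \<mu>) (adj (Sw \<gamma>) * (\<psi> (Sw \<mu>) * adj (\<psi> (Sw \<mu>))) * Sw \<gamma>'))"
    by (simp add: sum_distrib_left sum_distrib_right mult_scaleC_left mult_scaleC_right)
  then show ?thesis unfolding P_def[symmetric] by (simp add: zero)
qed

text \<open>
  The entries of the column of \<open>z\<close> at \<open>\<alpha>\<close> satisfy \<open>Z \<gamma> * cnj (Z \<gamma>') = 0\<close> for \<open>\<gamma> \<noteq> \<gamma>'\<close> by \<open>off_diagonal_zero\<close>, and not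
  all of them vanish.
\<close>

lemma z_permutes_words:
  assumes \<alpha>: "\<alpha> \<in> words n m"
  shows "\<exists>\<gamma>\<in>words n m. \<exists>c. c \<noteq> 0 \<and> z * Sw \<alpha> = scaleC c (Sw \<gamma>)"
proof -
  obtain Z where Z: "\<And>\<gamma>. \<gamma> \<in> words n m \<Longrightarrow> adj (Sw \<gamma>) * z * Sw \<alpha> = scaleC (Z \<gamma>) 1"
    using z_scalar_coefficients[OF _ \<alpha>] by metis
  have col: "z * Sw \<alpha> = (\<Sum>\<gamma>\<in>words n m. scaleC (Z \<gamma>) (Sw \<gamma>))"
  proof -
    have "z * Sw \<alpha> = (\<Sum>\<gamma>\<in>words n m. Sw \<gamma> * adj (Sw \<gamma>)) * (z * Sw \<alpha>)" by (simp add: sum_word_ranges)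
    also have "\<dots> = (\<Sum>\<gamma>\<in>words n m. Sw \<gamma> * (adj (Sw \<gamma>) * z * Sw \<alpha>))"
      by (simp add: sum_distrib_right mult.assoc)
    also have "\<dots> = (\<Sum>\<gamma>\<in>words n m. scaleC (Z \<gamma>) (Sw \<gamma>))"
      by (intro sum.cong) (simp_all add: Z mult_scaleC_right)
    finally show ?thesis .
  qed
  have nz: "z * Sw \<alpha> \<noteq> 0"
  proof
    assume "z * Sw \<alpha> = 0"
    then have "adj z * (z * Sw \<alpha>) = 0" by simp
    then show False using Sw_nonzero[of \<alpha>] \<alpha> by (simp add: zz_left words_def)
  qed
  then obtain \<gamma> where \<gamma>: "\<gamma> \<in> words n m" "Z \<gamma> \<noteq> 0"
    unfolding col by (metis (no_types, lifting) scaleC_zero_left sum.neutral)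
  have other: "Z \<gamma>' = 0" if \<gamma>': "\<gamma>' \<in> words n m" "\<gamma>' \<noteq> \<gamma>" for \<gamma>'
  proof -
    have "adj (Sw \<gamma>) * (z * (Sw \<alpha> * adj (Sw \<alpha>)) * adj z) * Sw \<gamma>'
        = (adj (Sw \<gamma>) * z * Sw \<alpha>) * adj (adj (Sw \<gamma>') * z * Sw \<alpha>)"
      by (simp add: adj_mult adj_adj mult.assoc)
    also have "\<dots> = scaleC (Z \<gamma> * cnj (Z \<gamma>')) 1"
      using Z \<gamma> \<gamma>' by (simp add: adj_scaleC adj_one mult_scaleC_left scaleC_scaleC)
    finally have "scaleC (Z \<gamma> * cnj (Z \<gamma>')) (1::'a) = 0"
      using off_diagonal_zero[OF \<alpha> \<gamma>(1) \<gamma>'(1)] \<gamma>' by simp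
    then show ?thesis using \<gamma> by (simp add: scaleC_eq_0_iff)
  qed
  have "z * Sw \<alpha> = (\<Sum>\<gamma>'\<in>words n m. if \<gamma>' = \<gamma> then scaleC (Z \<gamma>) (Sw \<gamma>) else 0)"
    unfolding col by (intro sum.cong) (auto simp: other)
  then have "z * Sw \<alpha> = scaleC (Z \<gamma>) (Sw \<gamma>)" using \<gamma> by simp
  then show ?thesis using \<gamma> by blast
qed

lemma scaled_Sw_eq:
  assumes "scaleC c (Sw \<alpha>) = scaleC d (Sw \<beta>)" "c \<noteq> 0" "\<alpha> \<in> words n p" "\<beta> \<in> words n p"
  shows "\<alpha> = \<beta>"
proof (rule ccontr)
  assume "\<alpha> \<noteq> \<beta>"
  have "adj (Sw \<alpha>) * scaleC c (Sw \<alpha>) = adj (Sw \<alpha>) * scaleC d (Sw \<beta>)" by (simp only: assms(1))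
  moreover have "adj (Sw \<alpha>) * Sw \<alpha> = 1" "adj (Sw \<alpha>) * Sw \<beta> = 0"
    using assms \<open>\<alpha> \<noteq> \<beta>\<close> adj_Sw_mult_Sw[of \<alpha> \<alpha>] adj_Sw_mult_Sw[of \<alpha> \<beta>] by (auto simp: words_def)
  ultimately have "scaleC c (1::'a) = 0" by (simp add: mult_scaleC_right)
  then show False using assms by (simp add: scaleC_eq_0_iff)
qed

text \<open>
  \<open>h\<close> is the permutation of words underlying \<open>z\<close>. Applying \<open>z \<phi> (S\<^sub>i) = \<psi> (S\<^sub>i) z\<close> to \<open>S\<^sub>\<alpha>\<close> compares two words
  up to nonzero scalars; equal words have equal initial parts, whatever their last letters are.
\<close>

lemma obtain_conjugating_bijection:
  obtains h where "bij_betw h (words n m) (words n m)"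
    and "\<And>i \<alpha> \<beta> \<beta>' l l'. i \<in> {1..n} \<Longrightarrow> \<alpha> \<in> words n m \<Longrightarrow> \<beta> \<in> words n m \<Longrightarrow> \<beta>' \<in> words n m \<Longrightarrow>
      l \<in> {1..n} \<Longrightarrow> l' \<in> {1..n} \<Longrightarrow>
      \<phi> (S i) * Sw \<alpha> = Sw (\<beta> @ [l]) \<Longrightarrow> \<psi> (S i) * Sw (h \<alpha>) = Sw (\<beta>' @ [l']) \<Longrightarrow> h \<beta> = \<beta>'"
proof -
  have "\<forall>\<alpha>\<in>words n m. \<exists>\<gamma> c. \<gamma> \<in> words n m \<and> c \<noteq> 0 \<and> z * Sw \<alpha> = scaleC c (Sw \<gamma>)"
    using z_permutes_words by blast
  then obtain h c where h: "\<And>\<alpha>. \<alpha> \<in> words n m \<Longrightarrow> h \<alpha> \<in> words n m"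
    and c: "\<And>\<alpha>. \<alpha> \<in> words n m \<Longrightarrow> c \<alpha> \<noteq> 0"
    and zh: "\<And>\<alpha>. \<alpha> \<in> words n m \<Longrightarrow> z * Sw \<alpha> = scaleC (c \<alpha>) (Sw (h \<alpha>))"
    by metis
  have "inj_on h (words n m)"
  proof (rule inj_onI)
    fix \<alpha> \<beta> assume \<alpha>: "\<alpha> \<in> words n m" and \<beta>: "\<beta> \<in> words n m" and eq: "h \<alpha> = h \<beta>"
    have "scaleC (c \<beta>) (z * Sw \<alpha>) = scaleC (c \<alpha>) (z * Sw \<beta>)"
      by (simp add: zh \<alpha> \<beta> eq scaleC_scaleC mult.commute)
    then have "z * scaleC (c \<beta>) (Sw \<alpha>) = z * scaleC (c \<alpha>) (Sw \<beta>)" by (simp add: mult_scaleC_right)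
    then have "scaleC (c \<beta>) (Sw \<alpha>) = scaleC (c \<alpha>) (Sw \<beta>)" by (metis zz_left(1))
    then show "\<alpha> = \<beta>" using c \<alpha> \<beta> by (intro scaled_Sw_eq) auto
  qed
  moreover have "h ` words n m \<subseteq> words n m" using h by blast
  ultimately have bij: "bij_betw h (words n m) (words n m)"
    unfolding bij_betw_def using endo_inj_surj[of "words n m" h] by simp
  show thesis
  proof (rule that[OF bij])
    fix i \<alpha> \<beta> \<beta>' l l'
    assume i: "i \<in> {1..n}" and w: "\<alpha> \<in> words n m" "\<beta> \<in> words n m" "\<beta>' \<in> words n m" "l \<in> {1..n}" "l' \<in> {1..n}"
      and f: "\<phi> (S i) * Sw \<alpha> = Sw (\<beta> @ [l])" and g: "\<psi> (S i) * Sw (h \<alpha>) = Sw (\<beta>' @ [l'])"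
    have "z * (\<phi> (S i) * Sw \<alpha>) = scaleC (c \<beta>) (Sw (h \<beta> @ [l]))"
      unfolding f Sw_append mult.assoc[symmetric] zh[OF w(2)] by (simp only: mult_scaleC_left)
    moreover have "z * (\<phi> (S i) * Sw \<alpha>) = \<psi> (S i) * (z * Sw \<alpha>)"
      by (simp add: mult.assoc[symmetric] z_intertwines)
    moreover have "\<psi> (S i) * (z * Sw \<alpha>) = scaleC (c \<alpha>) (Sw (\<beta>' @ [l']))"
      unfolding zh[OF w(1)] mult_scaleC_right g ..
    ultimately have "scaleC (c \<beta>) (Sw (h \<beta> @ [l])) = scaleC (c \<alpha>) (Sw (\<beta>' @ [l']))" by simp
    moreover have "h \<beta> @ [l] \<in> words n (m + 1)" "\<beta>' @ [l'] \<in> words n (m + 1)"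
      using h[OF w(2)] w by (auto simp: words_def)
    ultimately have "h \<beta> @ [l] = \<beta>' @ [l']" using c[OF w(2)] scaled_Sw_eq by blast
    then show "h \<beta> = \<beta>'" by simp
  qed
qed

end

section \<open>Outer equivalence and trees\<close>

text \<open>
  A conjugacy of the maps takes fixed points to fixed points, so it respects the omission of the loop at
  the root.
\<close>

lemma digraph_iso_f_tree:
  assumes "1 \<le> k" and \<sigma>: "\<sigma> permutes words n k" and i: "i \<in> {1..n}"
    and h: "bij_betw h (words n (k - 1)) (words n (k - 1))"
    and conj: "\<And>\<alpha>. \<alpha> \<in> words n (k - 1) \<Longrightarrow> h (f_map n k \<sigma> i \<alpha>) = f_map n k \<tau> i (h \<alpha>)"
  shows "digraph_iso (f_tree n k \<sigma> i) (f_tree n k \<tau> i)"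
proof -
  let ?W = "words n (k - 1)" and ?f = "f_map n k \<sigma> i" and ?g = "f_map n k \<tau> i"
  define iso where "iso = \<lparr>iso_verts = h, iso_arcs = map_prod h h,
    iso_head = (snd :: nat list \<times> nat list \<Rightarrow> nat list), iso_tail = (fst :: nat list \<times> nat list \<Rightarrow> nat list)\<rparr>"
  have inj: "inj_on h ?W" and img: "h ` ?W = ?W" using h by (auto simp: bij_betw_def)
  have f: "?f \<alpha> \<in> ?W" if "\<alpha> \<in> ?W" for \<alpha>
    using theI'[OF f_map_ex1[OF assms(1) \<sigma> i that]] unfolding f_map_def by blast
  have wf: "wf_digraph (f_tree n k \<sigma> i)" using assms by (intro wf_digraph_f_tree)
  have arcs: "arcs (f_tree n k \<sigma> i) \<subseteq> ?W \<times> ?W" using f by (auto simp: f_tree_def)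
  have "inj_on (map_prod h h) (arcs (f_tree n k \<sigma> i))"
    using inj_on_subset[OF map_prod_inj_on[OF inj inj] arcs] .
  then have "pre_digraph.digraph_isomorphism (f_tree n k \<sigma> i) iso"
    unfolding pre_digraph.digraph_isomorphism_def
    using wf inj by (auto simp: iso_def f_tree_def)
  moreover have "f_tree n k \<tau> i = app_iso iso (f_tree n k \<sigma> i)"
  proof -
    have "{(\<beta>, ?g \<beta>) |\<beta>. \<beta> \<in> ?W \<and> ?g \<beta> \<noteq> \<beta>} = map_prod h h ` {(\<alpha>, ?f \<alpha>) |\<alpha>. \<alpha> \<in> ?W \<and> ?f \<alpha> \<noteq> \<alpha>}"
      (is "?L = ?R")
    proof
      show "?L \<subseteq> ?R"
      proof
        fix x assume "x \<in> ?L"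
        then obtain \<beta> where \<beta>: "x = (\<beta>, ?g \<beta>)" "\<beta> \<in> ?W" "?g \<beta> \<noteq> \<beta>" by blast
        then obtain \<alpha> where \<alpha>: "\<alpha> \<in> ?W" "\<beta> = h \<alpha>" using img by blast
        then have "x = map_prod h h (\<alpha>, ?f \<alpha>)" "?f \<alpha> \<noteq> \<alpha>" using \<beta> conj[of \<alpha>] by auto
        then show "x \<in> ?R" using \<alpha> by blast
      qed
      show "?R \<subseteq> ?L"
      proof
        fix x assume "x \<in> ?R"
        then obtain \<alpha> where \<alpha>: "x = (h \<alpha>, h (?f \<alpha>))" "\<alpha> \<in> ?W" "?f \<alpha> \<noteq> \<alpha>" by auto
        then have "h (?f \<alpha>) \<noteq> h \<alpha>" using inj_onD[OF inj _ f[OF \<alpha>(2)] \<alpha>(2)] by blast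
        then have "x = (h \<alpha>, ?g (h \<alpha>))" "?g (h \<alpha>) \<noteq> h \<alpha>" "h \<alpha> \<in> ?W"
          using \<alpha> conj[OF \<alpha>(2)] img by auto
        then show "x \<in> ?L" by blast
      qed
    qed
    then show ?thesis using img by (simp add: app_iso_def f_tree_def with_proj_def iso_def)
  qed
  ultimately show ?thesis unfolding digraph_iso_def by blast
qed

lemma out_class_eqE:
  assumes "\<phi> \<in> carrier Aut" "\<psi> \<in> carrier Aut" "out_class \<phi> = out_class \<psi>"
  obtains z where "unitary z" "\<And>x. \<psi> x = z * \<phi> x * adj z"
proof -
  have "id \<in> Inn" by (auto simp: Inn_def unitary_def adj_one fun_eq_iff intro!: exI[of _ 1])
  then have "\<psi> \<in> out_class \<psi>"
    unfolding out_class_def r_coset_def by (intro UN_I[of id]) (simp_all add: Aut_def)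
  then have "\<psi> \<in> out_class \<phi>" using assms by simp
  then obtain a where "a \<in> Inn" "\<psi> = a \<circ> \<phi>" by (auto simp: out_class_def r_coset_def Aut_def)
  then show thesis using that by (auto simp: Inn_def)
qed

theorem proposition4p8:
  fixes n k :: nat
    and S :: "nat \<Rightarrow> 'a::unital_cstar_algebra"
    and u w :: 'a
    and \<sigma> \<tau> :: "nat list \<Rightarrow> nat list"
    and \<phi> \<psi> :: "'a \<Rightarrow> 'a"
  assumes "2 \<le> n" and "1 \<le> k"
    and "cuntz_algebra n S"
    and "perm_unitary n k S u \<sigma>" and "perm_unitary n k S w \<tau>"
    and "is_lambda n S u \<phi>" and "is_lambda n S w \<psi>"
    and "\<phi> \<in> carrier Aut" and "\<psi> \<in> carrier Aut"
    and "\<exists>i\<in>{1..n}. \<not> digraph_iso (f_tree n k \<sigma> i) (f_tree n k \<tau> i)"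
  shows "out_class \<phi> \<noteq> out_class \<psi>"
proof
  assume "out_class \<phi> = out_class \<psi>"
  then obtain z where z: "unitary z" "\<And>x. \<psi> x = z * \<phi> x * adj z"
    using out_class_eqE assms(8,9) by blast
  interpret cuntz n S by unfold_locales (rule assms)
  note k = \<open>1 \<le> k\<close> and u = assms(4) and w = assms(5)
  have \<phi>_S: "\<phi> (S i) = adj u * S i" and \<psi>_S: "\<psi> (S i) = adj w * S i" if "i \<in> {1..n}" for i
    using assms(6,7) that by (auto simp: is_lambda_def)
  interpret inner_conjugate n S \<phi> \<psi> z "k - 1"
  proof unfold_locales
    show "unital_star_endomorphism \<phi>" "bij \<phi>" using assms(8) by (auto simp: Aut_def)
    show "maps_words (k - 1) 1 (\<phi> (S i))" "maps_words (k - 1) 1 (\<psi> (S i))" if "i \<in> {1..n}" for i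
      using maps_words_lambda[OF u k that] maps_words_lambda[OF w k that] \<phi>_S[OF that] \<psi>_S[OF that] by simp_all
  qed (rule z)+
  obtain h where h: "bij_betw h (words n (k - 1)) (words n (k - 1))"
    and conj: "\<And>i \<alpha> \<beta> \<beta>' l l'. i \<in> {1..n} \<Longrightarrow> \<alpha> \<in> words n (k - 1) \<Longrightarrow> \<beta> \<in> words n (k - 1) \<Longrightarrow>
      \<beta>' \<in> words n (k - 1) \<Longrightarrow> l \<in> {1..n} \<Longrightarrow> l' \<in> {1..n} \<Longrightarrow>
      \<phi> (S i) * Sw \<alpha> = Sw (\<beta> @ [l]) \<Longrightarrow> \<psi> (S i) * Sw (h \<alpha>) = Sw (\<beta>' @ [l']) \<Longrightarrow> h \<beta> = \<beta>'"
    using obtain_conjugating_bijection by blast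
  have "h (f_map n k \<sigma> i \<alpha>) = f_map n k \<tau> i (h \<alpha>)"
    if i: "i \<in> {1..n}" and \<alpha>: "\<alpha> \<in> words n (k - 1)" for i \<alpha>
  proof -
    have h\<alpha>: "h \<alpha> \<in> words n (k - 1)" using h \<alpha> by (auto simp: bij_betw_def)
    obtain l where l: "l \<in> {1..n}" "f_map n k \<sigma> i \<alpha> \<in> words n (k - 1)"
      "adj u * S i * Sw \<alpha> = Sw (f_map n k \<sigma> i \<alpha> @ [l])"
      using lambda_f_map[OF u k i \<alpha>] by blast
    obtain l' where l': "l' \<in> {1..n}" "f_map n k \<tau> i (h \<alpha>) \<in> words n (k - 1)"
      "adj w * S i * Sw (h \<alpha>) = Sw (f_map n k \<tau> i (h \<alpha>) @ [l'])"
      using lambda_f_map[OF w k i h\<alpha>] by blast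
    show ?thesis
      using conj[OF i \<alpha> l(2) l'(2) l(1) l'(1)] l(3) l'(3) \<phi>_S[OF i] \<psi>_S[OF i] by simp
  qed
  then have "digraph_iso (f_tree n k \<sigma> i) (f_tree n k \<tau> i)" if "i \<in> {1..n}" for i
    using u k h that by (intro digraph_iso_f_tree) (auto simp: perm_unitary_def)
  then show False using assms(10) by blast
qed

end
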